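(* (a) Let $p\in(0,1)$. Suppose that for every finite connected graph $G$ and every $T\subset V(G)$, Bernoulli percolation with parameter $p$ on the bunkbed graph $G_T$ satisfies $$\forall o,v\in V(G):\quad \mathbb{P}_p((o,0)\leftrightarrow(v,0))\ge\mathbb{P}_p((o,0)\leftrightarrow(v,1)).$$ Then for every finite connected graph $G$, Bernoulli percolation with parameter $p$ on the layered graph $G^\times$ satisfies $$\forall o,v\in V(G)\ \forall\, 0\le n\le n':\quad \mathbb{P}_p((o,0)\leftrightarrow(v,n))\ge\mathbb{P}_p((o,0)\leftrightarrow(v,n')).\qquad(\mathrm{L})$$ (b) Let $p\in(0,1)$ and $d\ge2$. Suppose that for every $k\ge2$, property $(\mathrm{L})$ holds with $G=C_k^{d-1}$, i.e. for Bernoulli percolation with parameter $p$ on the layered graph $(C_k^{d-1})^\times$. Then Bernoulli percolation with parameter $p$ on $\mathbb{Z}^d$ satisfies $$\forall o,u,v\in\mathbb{Z}^d:\quad o\le u\le v\ \Rightarrow\ \mathbb{P}_p(o\leftrightarrow u)\ge\mathbb{P}_p(o\leftrightarrow v).$$ The same is true with $L_k^{d-1}$ instead of $C_k^{d-1}$.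
   Context: Graphs are simple. Bernoulli (bond) percolation with parameter $p$ on a graph $H$: independent random variables $\mathcal{Z}_e$, $e\in E(H)$, with $\mathbb{P}_p(\mathcal{Z}_e=1)=p$ (open) and $\mathbb{P}_p(\mathcal{Z}_e=0)=1-p$ (closed); $u\leftrightarrow v$ is the event that there is a path of open edges from $u$ to $v$. Bunkbed graph $G_T$ (for a graph $G$ and $T\subset V(G)$): vertex set $V(G)\times\{0,1\}$; edges $(u,l)(v,l)$ for $uv\in E(G)$, $l\in\{0,1\}$, and $(u,0)(u,1)$ for $u\in T$. Layered graph $G^\times$: vertex set $V(G)\times\mathbb{Z}$; edges $(u,l)(v,l)$ for $uv\in E(G)$, $l\in\mathbb{Z}$, and $(u,l-1)(u,l)$ for $u\in V(G)$, $l\in\mathbb{Z}$. In $(\mathrm{L})$, $n,n'$ are integers. $\mathbb{Z}^d$ is the graph on the integer lattice in which two vertices are adjacent iff their Euclidean distance is $1$; $\le$ on $\mathbb{Z}^d$ is the componentwise partial order. $L_k$ and $C_k$ are the linear (path) graph and the cycle graph on $k\ge2$ vertices, with the convention $C_2:=L_2$; $L_k^{d-1}$ and $C_k^{d-1}$ are the Cartesian products of $d-1$ copies of $L_k$ and $C_k$, respectively. *)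

theory Defs
  imports "HOL-Probability.Probability"
begin

text \<open>A graph is a vertex set together with a set of edges, an edge being the two-element set of
  its endpoints.\<close>

datatype 'a sgraph = SGraph (verts: "'a set") (edges: "'a set set")

definition simple_graph :: "'a sgraph \<Rightarrow> bool" where
  "simple_graph G \<longleftrightarrow> edges G \<subseteq> {{u, v} |u v. u \<in> verts G \<and> v \<in> verts G \<and> u \<noteq> v}"

definition path_between :: "'a set set \<Rightarrow> 'a \<Rightarrow> 'a list \<Rightarrow> 'a \<Rightarrow> bool" where
  "path_between F u xs v \<longleftrightarrow>
     xs \<noteq> [] \<and> hd xs = u \<and> last xs = v \<and> distinct xs \<and> successively (\<lambda>x y. {x, y} \<in> F) xs"

definition connected_graph :: "'a sgraph \<Rightarrow> bool" where
  "connected_graph G \<longleftrightarrow>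
     verts G \<noteq> {} \<and> (\<forall>u\<in>verts G. \<forall>v\<in>verts G. \<exists>xs. path_between (edges G) u xs v)"

definition finite_connected_graph :: "'a sgraph \<Rightarrow> bool" where
  "finite_connected_graph G \<longleftrightarrow> simple_graph G \<and> finite (verts G) \<and> connected_graph G"

text \<open>A configuration \<open>\<omega>\<close> assigns to each edge its state, \<open>True\<close> meaning open. The coordinates of the
  product measure are independent Bernoulli variables. On a graph with countably many vertices
  the event \<open>connection_event p H u v\<close> is measurable, being a countable union over paths.\<close>

definition percolation :: "real \<Rightarrow> 'a sgraph \<Rightarrow> ('a set \<Rightarrow> bool) measure" where
  "percolation p H = Pi\<^sub>M (edges H) (\<lambda>_. measure_pmf (bernoulli_pmf p))"

definition open_edges :: "'a sgraph \<Rightarrow> ('a set \<Rightarrow> bool) \<Rightarrow> 'a set set" where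
  "open_edges H \<omega> = {e \<in> edges H. \<omega> e}"

definition connection_event ::
    "real \<Rightarrow> 'a sgraph \<Rightarrow> 'a \<Rightarrow> 'a \<Rightarrow> ('a set \<Rightarrow> bool) set" where
  "connection_event p H u v =
     {\<omega> \<in> space (percolation p H). \<exists>xs. path_between (open_edges H \<omega>) u xs v}"

definition connection_prob :: "real \<Rightarrow> 'a sgraph \<Rightarrow> 'a \<Rightarrow> 'a \<Rightarrow> real" where
  "connection_prob p H u v = measure (percolation p H) (connection_event p H u v)"

definition bunkbed_graph :: "'a sgraph \<Rightarrow> 'a set \<Rightarrow> ('a \<times> nat) sgraph" where
  "bunkbed_graph G T = SGraph (verts G \<times> {0, 1})
     ({{(u, l), (v, l)} |u v l. {u, v} \<in> edges G \<and> l \<in> {0, 1}} \<union> {{(u, 0), (u, 1)} |u. u \<in> T})"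

definition layered_graph :: "'a sgraph \<Rightarrow> ('a \<times> int) sgraph" where
  "layered_graph G = SGraph (verts G \<times> UNIV)
     ({{(u, l), (v, l)} |u v l. {u, v} \<in> edges G} \<union> {{(u, l - 1), (u, l)} |u l. u \<in> verts G})"

definition bunkbed_property :: "real \<Rightarrow> 'a sgraph \<Rightarrow> 'a set \<Rightarrow> bool" where
  "bunkbed_property p G T \<longleftrightarrow>
     (\<forall>w\<in>verts G. \<forall>v\<in>verts G.
        connection_prob p (bunkbed_graph G T) (w, 0) (v, 0)
          \<ge> connection_prob p (bunkbed_graph G T) (w, 0) (v, 1))"

definition layered_property :: "real \<Rightarrow> 'a sgraph \<Rightarrow> bool" where
  "layered_property p G \<longleftrightarrow>
     (\<forall>w\<in>verts G. \<forall>v\<in>verts G. \<forall>n n'. 0 \<le> n \<and> n \<le> n' \<longrightarrow>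
        connection_prob p (layered_graph G) (w, 0) (v, n)
          \<ge> connection_prob p (layered_graph G) (w, 0) (v, n'))"

definition linear_graph :: "nat \<Rightarrow> nat sgraph" where
  "linear_graph k = SGraph {..<k} {{i, i + 1} |i. i + 1 < k}"

definition cycle_graph :: "nat \<Rightarrow> nat sgraph" where
  "cycle_graph k = SGraph {..<k} {{i, (i + 1) mod k} |i. i < k}"

text \<open>Edges being sets, the cycle on two vertices has a single edge, in accordance with the
  convention that it is the linear graph.\<close>

lemma cycle_graph_2: "cycle_graph 2 = linear_graph 2"
proof -
  have "{{i, (i + 1) mod 2} |i. i < (2::nat)} = {{0, 1}}"
    by (auto simp: less_2_cases_iff intro!: exI[of _ 0])
  moreover have "{{i, i + 1} |i. i + 1 < (2::nat)} = {{0, 1}}"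
    by auto
  ultimately show ?thesis
    by (simp add: cycle_graph_def linear_graph_def)
qed

text \<open>Cartesian product of \<open>m\<close> copies of a graph. Here and for the integer lattice, the vertices
  are the functions on \<open>{..<m}\<close>, extended by \<open>undefined\<close>.\<close>

definition cartesian_power :: "'a sgraph \<Rightarrow> nat \<Rightarrow> (nat \<Rightarrow> 'a) sgraph" where
  "cartesian_power G m = SGraph ({..<m} \<rightarrow>\<^sub>E verts G)
     {{x, y} |x y. x \<in> {..<m} \<rightarrow>\<^sub>E verts G \<and> y \<in> {..<m} \<rightarrow>\<^sub>E verts G \<and>
        (\<exists>i<m. {x i, y i} \<in> edges G \<and> (\<forall>j<m. j \<noteq> i \<longrightarrow> x j = y j))}"

definition int_lattice :: "nat \<Rightarrow> (nat \<Rightarrow> int) sgraph" where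
  "int_lattice d = SGraph ({..<d} \<rightarrow>\<^sub>E UNIV)
     {{x, y} |x y. x \<in> {..<d} \<rightarrow>\<^sub>E UNIV \<and> y \<in> {..<d} \<rightarrow>\<^sub>E UNIV \<and>
        L2_set (\<lambda>i. real_of_int (x i - y i)) {..<d} = 1}"

definition lattice_le :: "nat \<Rightarrow> (nat \<Rightarrow> int) \<Rightarrow> (nat \<Rightarrow> int) \<Rightarrow> bool" where
  "lattice_le d x y \<longleftrightarrow> (\<forall>i<d. x i \<le> y i)"

definition lattice_monotone :: "real \<Rightarrow> nat \<Rightarrow> bool" where
  "lattice_monotone p d \<longleftrightarrow>
     (\<forall>w\<in>verts (int_lattice d). \<forall>u\<in>verts (int_lattice d). \<forall>v\<in>verts (int_lattice d).
        lattice_le d w u \<and> lattice_le d u v \<longrightarrow>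
        connection_prob p (int_lattice d) w u \<ge> connection_prob p (int_lattice d) w v)"

end

theory Submission imports Defs
begin

text \<open>
  Part (a): the reflection at height \<open>n + 1/2\<close> turns the slab of the layered graph between the layers
  \<open>n - k\<close> and \<open>n + 1 + k\<close> into a bunkbed graph over the lower half of the slab, with \<open>T\<close> the layer \<open>n\<close>.
  The bunkbed property compares the layers \<open>n\<close> and \<open>n + 1\<close>; let \<open>k\<close> tend to infinity.

  Part (b): large cubes around the origin of the integer lattice embed into the layered graphs. A connection
  in the layered graph is a connection inside the cube unless both points are joined to the
  boundary of the cube by different clusters. This exceptional event has vanishing probability, which is
  uniqueness of the infinite cluster. It is needed in a quantitative finite form, proved in the manner of
  Aizenman, Kesten and Newman: exploring one cluster, the number of open edges it touches
  differs from \<open>p\<close> times the number of all edges it touches by a fluctuation of the order of the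
  square root. Summing over the boundary clusters of a cube counts the closed
  edges between two of them twice, exploring all of them at once counts these edges only once, so there
  are few such edges; by translation invariance and finite energy the claim follows.
\<close>

section \<open>Connections and percolation on finite edge sets\<close>

text \<open>The exceptional event of part (b) depends on finitely many edges, so the estimates are
  weighted sums over subsets of a finite edge set, and measure theory enters only through limits
  along exhaustions. The error arises for one of the two targets only: a finite subgraph bounds
  every connection probability from below, so the farther target costs nothing and the nearer one
  carries the whole error.

  The fluctuation of a cluster is controlled not by a variance but by a product of mean-one factors
  1 - t g over the explored edges, g being the centred state of an edge. These products are
  positive, so they may be summed over all boundary vertices instead of over the random set of
  clusters. In a cube of radius n the mean number of bridges is then at most of order n^(d-1)/t + t
  n^d; the choice t = 1/sqrt n balances the terms and makes the density of bridges at most of order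
  1/sqrt n.

  Finite energy is applied along a fixed path while the cube grows, so its cost, a power of 1/p,
  stays bounded.\<close>

definition adjacency :: "'a set set \<Rightarrow> ('a \<times> 'a) set" where
  "adjacency F = {(x, y). {x, y} \<in> F}"

abbreviation linked :: "'a set set \<Rightarrow> 'a \<Rightarrow> 'a \<Rightarrow> bool" where
  "linked F x y \<equiv> (x, y) \<in> (adjacency F)\<^sup>*"

lemma sym_adjacency: "sym (adjacency F)"
  by (auto simp: adjacency_def sym_def insert_commute)

lemma linked_sym: "linked F x y \<Longrightarrow> linked F y x"
  using sym_rtrancl[OF sym_adjacency] by (rule symD)

lemma linked_edge: "{x, y} \<in> F \<Longrightarrow> linked F x y"
  by (auto simp: adjacency_def)

lemma linked_mono: "linked F x y \<Longrightarrow> F \<subseteq> F' \<Longrightarrow> linked F' x y"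
  using rtrancl_mono[of "adjacency F" "adjacency F'"] by (auto simp: adjacency_def)

lemma linked_if_path: "path_between F u xs v \<Longrightarrow> linked F u v"
proof (induction xs arbitrary: u)
  case (Cons x xs)
  show ?case
  proof (cases xs)
    case (Cons y ys)
    with Cons.prems have "path_between F y xs v" "{u, y} \<in> F"
      by (auto simp: path_between_def)
    with Cons.IH[of y] linked_edge[of u y F] show ?thesis by auto
  qed (use Cons.prems in \<open>auto simp: path_between_def\<close>)
qed (auto simp: path_between_def)

lemma path_if_linked:
  assumes "linked F u v"
  obtains xs where "path_between F u xs v"
proof -
  from assms have "\<exists>xs. path_between F u xs v"
  proof (induction rule: converse_rtrancl_induct)
    case base
    have "path_between F v [v] v" by (simp add: path_between_def)
    then show ?case ..
  next
    case (step x y)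
    then obtain xs where xs: "path_between F y xs v" by blast
    have xy: "{x, y} \<in> F" using step(1) by (simp add: adjacency_def)
    show ?case
    proof (cases "x \<in> set xs")
      \<comment> \<open>Loop erasure: the walk returns to \<open>x\<close>, so the part of
        \<open>xs\<close> before that visit is dropped to keep the path
        \<open>distinct\<close>.\<close>
      case True
      then obtain ys zs where s: "xs = ys @ x # zs" by (auto dest: split_list)
      have "path_between F x (x # zs) v"
        using xs by (auto simp: path_between_def s successively_append_iff)
      then show ?thesis ..
    next
      case False
      then have "path_between F x (x # xs) v"
        using xs xy by (auto simp: path_between_def successively_Cons)
      then show ?thesis ..
    qed
  qed
  then show ?thesis using that by blast
qed

lemma path_iff_linked: "(\<exists>xs. path_between F u xs v) \<longleftrightarrow> linked F u v"
  using linked_if_path path_if_linked by metis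

lemma linked_image:
  assumes inj: "inj_on f V" and F: "\<Union>F \<subseteq> V" and "u \<in> V" "v \<in> V"
  shows "linked ((`) f ` F) (f u) (f v) \<longleftrightarrow> linked F u v"
proof
  assume "linked F u v"
  then show "linked ((`) f ` F) (f u) (f v)"
  proof (induction rule: rtrancl_induct)
    case (step y z)
    then have "{f y, f z} \<in> (`) f ` F"
      by (auto simp: adjacency_def intro!: image_eqI[of _ _ "{y, z}"])
    with step.IH show ?case
      by (auto simp: adjacency_def intro: rtrancl_into_rtrancl)
  qed simp
next
  assume "linked ((`) f ` F) (f u) (f v)"
  \<comment> \<open>Generalising over \<open>v\<close> loses its membership in \<open>V\<close>, so
    the claim is about some preimage \<open>w\<close> in \<open>V\<close>; injectivity then
    identifies it with \<open>v\<close>.\<close>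
  then have "\<exists>w\<in>V. f w = f v \<and> linked F u w"
  proof (induction "f v" arbitrary: v rule: rtrancl_induct)
    case base
    then show ?case using \<open>u \<in> V\<close> by auto
  next
    case (step y)
    from step(2) obtain e where e: "e \<in> F" "{y, f v} = f ` e"
      by (auto simp: adjacency_def)
    then have eV: "e \<subseteq> V" using F by auto
    obtain a b where ab: "a \<in> e" "b \<in> e" "f a = y" "f b = f v"
      using e(2) by (metis imageE insertI1 insertI2)
    have "f ` e = f ` {a, b}" using e(2) ab by auto
    then have "e = {a, b}"
      using inj_on_image_eq_iff[OF inj eV, of "{a, b}"] ab eV by blast
    moreover obtain w where "w \<in> V" "f w = f a" "linked F u w"
      using step(3)[of a] ab by auto
    moreover then have "w = a" using inj eV ab by (auto dest: inj_onD)
    ultimately have "linked F u b"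
      using linked_edge[of a b F] e by auto
    then show ?case using ab eV by auto
  qed
  then show "linked F u v" using inj \<open>v \<in> V\<close> by (auto dest: inj_onD)
qed

text \<open>The two-arm event. With \<open>B\<close> the boundary of a finite region it is the
  finite-volume substitute for the coexistence of two infinite clusters.\<close>

definition two_arms :: "'a set \<Rightarrow> 'a set set \<Rightarrow> 'a \<Rightarrow> 'a \<Rightarrow> bool" where
  "two_arms B S x y \<longleftrightarrow> (\<exists>b\<in>B. linked S x b) \<and> (\<exists>b\<in>B. linked S y b) \<and> \<not> linked S x y"

lemma two_arms_image:
  assumes "inj_on f V" "\<Union>S \<subseteq> V" "x \<in> V" "y \<in> V" "B \<subseteq> V"
  shows "two_arms (f ` B) ((`) f ` S) (f x) (f y) \<longleftrightarrow> two_arms B S x y"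
  using linked_image[OF assms(1,2)] assms(3-5)
  unfolding two_arms_def by (auto simp: subset_iff)

text \<open>A walk can step out of \<open>L\<close> only from a vertex of \<open>B\<close>, so up to
  its first visit to \<open>B\<close> it uses edges inside \<open>L\<close> alone. This cuts a
  connection in a large graph down to an event inside a box.\<close>

lemma linked_leaves:
  assumes "linked S x z" "x \<in> L"
    and nb: "\<And>y z. y \<in> L - B \<Longrightarrow> {y, z} \<in> S \<Longrightarrow> z \<in> L"
  shows "(\<exists>b\<in>B. linked {e \<in> S. e \<subseteq> L} x b) \<or> z \<in> L \<and> linked {e \<in> S. e \<subseteq> L} x z"
  using assms(1)
proof (induction rule: rtrancl_induct)
  case (step y z)
  show ?case
  proof (cases "\<exists>b\<in>B. linked {e \<in> S. e \<subseteq> L} x b")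
    case False
    with step.IH have y: "y \<in> L" "linked {e \<in> S. e \<subseteq> L} x y" by auto
    with False have "y \<notin> B" by auto
    with y step(2) have "z \<in> L" using nb[of y z] by (auto simp: adjacency_def)
    with y step(2) have "(y, z) \<in> adjacency {e \<in> S. e \<subseteq> L}"
      by (auto simp: adjacency_def)
    with y(2) have "linked {e \<in> S. e \<subseteq> L} x z" by (rule rtrancl_into_rtrancl)
    with \<open>z \<in> L\<close> show ?thesis by blast
  qed auto
qed (use assms(2) in auto)

section \<open>Independent edge states as weighted sums over subsets\<close>

definition expect :: "real \<Rightarrow> 'e set \<Rightarrow> ('e set \<Rightarrow> real) \<Rightarrow> real" where
  "expect p E f = (\<Sum>S\<in>Pow E. (\<Prod>e\<in>E. if e \<in> S then p else 1 - p) * f S)"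

abbreviation prb :: "real \<Rightarrow> 'e set \<Rightarrow> ('e set \<Rightarrow> bool) \<Rightarrow> real" where
  "prb p E Q \<equiv> expect p E (\<lambda>S. of_bool (Q S))"

lemma expect_empty [simp]: "expect p {} f = f {}"
  by (simp add: expect_def)

text \<open>Conditioning on the state of one edge; the exploration arguments and the finite energy
  estimate both rest on this recursion.\<close>

lemma expect_insert:
  assumes "finite E" "e \<notin> E"
  shows "expect p (insert e E) f = p * expect p E (\<lambda>S. f (insert e S)) + (1 - p) * expect p E f"
proof -
  let ?w = "\<lambda>E S. \<Prod>e\<in>E. if e \<in> S then p else 1 - p"
  have inj: "inj_on (insert e) (Pow E)"
    using assms(2) by (intro inj_onI) (metis Diff_insert_absorb PowD subsetD)
  have 1: "?w (insert e E) (insert e S) = p * ?w E S" if "S \<in> Pow E" for S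
  proof -
    have "(\<Prod>x\<in>E. if x \<in> insert e S then p else 1 - p) = ?w E S"
      using assms by (intro prod.cong) auto
    then show ?thesis using assms by simp
  qed
  have 2: "?w (insert e E) S = (1 - p) * ?w E S" if "S \<in> Pow E" for S
    using assms that by auto
  have "expect p (insert e E) f = (\<Sum>S\<in>Pow E. ?w (insert e E) S * f S)
     + (\<Sum>S\<in>insert e ` Pow E. ?w (insert e E) S * f S)"
    unfolding expect_def Pow_insert using assms
    by (intro sum.union_disjoint) auto
  also have "(\<Sum>S\<in>insert e ` Pow E. ?w (insert e E) S * f S)
      = (\<Sum>S\<in>Pow E. ?w (insert e E) (insert e S) * f (insert e S))"
    by (simp only: sum.reindex[OF inj] o_def)
  also have "\<dots> = (\<Sum>S\<in>Pow E. p * (?w E S * f (insert e S)))"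
    by (intro sum.cong refl) (simp only: 1 mult.assoc)
  also have "(\<Sum>S\<in>Pow E. ?w (insert e E) S * f S) = (\<Sum>S\<in>Pow E. (1 - p) * (?w E S * f S))"
    by (intro sum.cong refl) (simp only: 2 mult.assoc)
  finally show ?thesis
    by (simp add: expect_def sum_distrib_left)
qed

lemma expect_cong:
  "(\<And>S. S \<subseteq> E \<Longrightarrow> f S = g S) \<Longrightarrow> expect p E f = expect p E g"
  unfolding expect_def by (intro sum.cong refl arg_cong2[of _ _ _ _ "(*)"]) (simp only: Pow_iff)

lemma expect_add: "expect p E (\<lambda>S. f S + g S) = expect p E f + expect p E g"
  by (simp only: expect_def sum.distrib distrib_left)

lemma expect_cmult: "expect p E (\<lambda>S. c * f S) = c * expect p E f"
  by (simp add: expect_def sum_distrib_left algebra_simps)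

lemma expect_sum: "expect p E (\<lambda>S. \<Sum>i\<in>I. f i S) = (\<Sum>i\<in>I. expect p E (f i))"
  unfolding expect_def by (simp only: sum_distrib_left) (rule sum.swap)

lemma expect_const [simp]: "finite E \<Longrightarrow> expect p E (\<lambda>_. c) = c"
  by (induction E rule: finite_induct) (auto simp: expect_insert algebra_simps)

lemma expect_mono:
  assumes "0 \<le> p" "p \<le> 1" "\<And>S. S \<subseteq> E \<Longrightarrow> f S \<le> g S"
  shows "expect p E f \<le> expect p E g"
  unfolding expect_def
  using assms by (intro sum_mono mult_left_mono prod_nonneg) auto

lemma prb_mono:
  assumes "0 \<le> p" "p \<le> 1" "\<And>S. S \<subseteq> E \<Longrightarrow> Q S \<Longrightarrow> R S"
  shows "prb p E Q \<le> prb p E R"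
  using assms by (intro expect_mono) auto

lemma prb_union:
  assumes "0 \<le> p" "p \<le> 1" "\<And>S. S \<subseteq> E \<Longrightarrow> P S \<Longrightarrow> Q S \<or> R S"
  shows "prb p E P \<le> prb p E Q + prb p E R"
proof -
  have "(of_bool (P S) :: real) \<le> of_bool (Q S) + of_bool (R S)" if "S \<subseteq> E" for S
    using assms(3)[OF that] by (auto simp: of_bool_def)
  then show ?thesis
    unfolding expect_add[symmetric] using assms(1,2) by (rule expect_mono[rotated 2])
qed

text \<open>Edges outside \<open>F\<close> are integrated out one at a time, their two weights
  summing to 1.\<close>

lemma expect_restrict:
  assumes "finite E" "F \<subseteq> E"
  shows "expect p E (\<lambda>S. f (S \<inter> F)) = expect p F f"
proof -
  have "expect p (R \<union> F) (\<lambda>S. f (S \<inter> F)) = expect p F f"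
    if "finite R" "R \<inter> F = {}" for R
    using that
  proof (induction R rule: finite_induct)
    case empty
    show ?case by (auto intro!: expect_cong arg_cong[of _ _ f])
  next
    case (insert e R)
    then have "expect p (insert e (R \<union> F)) (\<lambda>S. f (S \<inter> F)) = expect p (R \<union> F) (\<lambda>S. f (S \<inter> F))"
      using assms by (subst expect_insert) (auto simp: finite_subset algebra_simps)
    with insert show ?case by simp
  qed
  from this[of "E - F"] assms show ?thesis by (simp add: Un_absorb2 Diff_disjoint inf_commute)
qed

lemma expect_image:
  assumes "inj_on h E"
  shows "expect p (h ` E) f = expect p E (\<lambda>S. f (h ` S))"
proof -
  have P: "Pow (h ` E) = image h ` Pow E" by (metis image_Pow_surj)
  have inj: "inj_on (image h) (Pow E)" using assms by (rule inj_on_image_Pow)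
  have "(\<Prod>x\<in>E. if h x \<in> h ` S then p else 1 - p) = (\<Prod>x\<in>E. if x \<in> S then p else 1 - p)"
    if "S \<subseteq> E" for S
    using that assms by (intro prod.cong) (auto simp: inj_on_image_mem_iff)
  then show ?thesis
    unfolding expect_def P using assms by (simp add: sum.reindex[OF inj] prod.reindex)
qed

text \<open>Finite energy. The event \<open>Q (insert e S)\<close> ignores the state of
  \<open>e\<close>, hence is independent of \<open>e\<close> being open, and together the two imply
  \<open>Q S\<close>.\<close>

lemma prb_insert_le:
  assumes "finite E" "e \<in> E" "0 < p" "p < 1"
  shows "prb p E (\<lambda>S. Q (insert e S)) \<le> prb p E Q / p"
proof -
  define E' where "E' = E - {e}"
  have E: "E = insert e E'" "finite E'" "e \<notin> E'" using assms by (auto simp: E'_def)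
  have "0 \<le> expect p E' (\<lambda>S. of_bool (Q S))"
    using expect_mono[of p E' "\<lambda>_. 0" "\<lambda>S. of_bool (Q S)"] assms E by simp
  then have "p * expect p E' (\<lambda>S. of_bool (Q (insert e S))) \<le> prb p E Q"
    using assms E by (simp add: expect_insert)
  then show ?thesis
    using assms E by (simp add: expect_insert field_simps)
qed

section \<open>Exploring the clusters of a set of seeds\<close>

definition reach :: "'a set set \<Rightarrow> 'a set \<Rightarrow> 'a set" where
  "reach S X = (adjacency S)\<^sup>* `` X"

definition touched :: "'a set set \<Rightarrow> 'a set set \<Rightarrow> 'a set \<Rightarrow> 'a set set" where
  "touched E S X = {e \<in> E. e \<inter> reach S X \<noteq> {}}"

lemma reach_superset: "X \<subseteq> reach S X"
  by (auto simp: reach_def)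

text \<open>Once an edge at a seed is known to be open, its ends can serve as seeds and the edge
  itself can be forgotten, so the exploration continues on the remaining edges.\<close>

lemma reach_insert_edge:
  assumes e: "e = {x, y}" and X: "x \<in> X"
  shows "reach (insert e S) X = reach S (X \<union> e)"
proof
  show "reach (insert e S) X \<subseteq> reach S (X \<union> e)"
  proof
    fix v assume "v \<in> reach (insert e S) X"
    then obtain u where u: "u \<in> X" "linked (insert e S) u v" by (auto simp: reach_def)
    from u(2) show "v \<in> reach S (X \<union> e)"
    proof (induction rule: rtrancl_induct)
      case (step a b)
      then consider "{a, b} = e" | "(a, b) \<in> adjacency S" by (auto simp: adjacency_def)
      then show ?case
      proof cases
        case 1 then show ?thesis using reach_superset[of "X \<union> e" S] by auto
      next
        case 2 with step.IH show ?thesis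
          by (auto simp: reach_def Image_iff intro: rtrancl_into_rtrancl)
      qed
    qed (use u reach_superset[of "X \<union> e" S] in auto)
  qed
  show "reach S (X \<union> e) \<subseteq> reach (insert e S) X"
  proof
    fix v assume "v \<in> reach S (X \<union> e)"
    then obtain u where u: "u \<in> X \<union> e" "linked S u v" by (auto simp: reach_def)
    have v: "linked (insert e S) u v" using u(2) by (rule linked_mono) auto
    have y: "linked (insert e S) x y" using e by (auto intro: linked_edge)
    from u e consider "u \<in> X" | "u = y" | "u = x" by auto
    then show "v \<in> reach (insert e S) X"
    proof cases
      case 2
      with y v have "linked (insert e S) x v" by auto
      with X show ?thesis by (auto simp: reach_def)
    qed (use v X in \<open>auto simp: reach_def\<close>)
  qed
qed

lemma touched_open:
  assumes "e = {x, y}" "x \<in> X"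
  shows "touched (insert e E) (insert e S) X = insert e (touched E S (X \<union> e))"
  using assms(1) reach_superset[of "X \<union> e" S] unfolding touched_def reach_insert_edge[OF assms] by auto

lemma touched_closed:
  assumes "e = {x, y}" "x \<in> X"
  shows "touched (insert e E) S X = insert e (touched E S X)"
  using assms reach_superset[of X S] by (auto simp: touched_def)

lemma touched_none:
  assumes "\<And>e. e \<in> E \<Longrightarrow> e \<inter> X = {}" "S \<subseteq> E"
  shows "touched E S X = {}"
proof -
  have "reach S X \<subseteq> X"
  proof
    fix v assume "v \<in> reach S X"
    then obtain u where "u \<in> X" "linked S u v" by (auto simp: reach_def)
    from this(2) \<open>u \<in> X\<close> show "v \<in> X"
    proof (induction rule: rtrancl_induct)
      case (step a b)
      then show ?case using assms by (fastforce simp: adjacency_def)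
    qed
  qed
  with assms(1) show ?thesis by (fastforce simp: touched_def)
qed

text \<open>Exploration as an induction rule: an edge at a seed is revealed and removed from
  \<open>E\<close>. Its ends become seeds if it is open, and the seeds stay as they are if it is
  closed; the two induction hypotheses are these two cases. The process stops when no remaining edge
  meets a seed.\<close>

lemma exploration_induct [case_names finite edges none step]:
  assumes "finite E" "\<And>e. e \<in> E \<Longrightarrow> \<exists>x y. e = {x, y}"
    and none: "\<And>E X. finite E \<Longrightarrow> (\<And>e. e \<in> E \<Longrightarrow> e \<inter> X = {}) \<Longrightarrow> P E X"
    and step: "\<And>E X e x y. finite E \<Longrightarrow> e \<notin> E \<Longrightarrow> e = {x, y} \<Longrightarrow> x \<in> X \<Longrightarrow> P E (X \<union> e) \<Longrightarrow> P E X
       \<Longrightarrow> P (insert e E) X"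
  shows "P E X"
  using assms(1,2)
proof (induction E arbitrary: X rule: finite_psubset_induct)
  case (psubset E X)
  show ?case
  proof (cases "\<exists>e\<in>E. e \<inter> X \<noteq> {}")
    case False
    then show ?thesis using psubset.hyps by (intro none) simp_all
  next
    case True
    then obtain e where e: "e \<in> E" "e \<inter> X \<noteq> {}" by auto
    obtain a b where "e = {a, b}" using psubset.prems[OF e(1)] by blast
    with e(2) obtain x y where xy: "e = {x, y}" "x \<in> X"
      by (cases "a \<in> X") auto
    have IH: "P (E - {e}) Y" for Y
      using e psubset.prems by (intro psubset.IH) auto
    have "P (insert e (E - {e})) X"
      using psubset.hyps by (intro step[OF _ _ xy] IH) auto
    then show ?thesis using e by (simp add: insert_absorb)
  qed
qed

text \<open>Optional stopping for a multiplicative martingale: whether an edge is revealed depends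
  only on the edges revealed before it, so its factor has conditional mean 1 by
  \<open>fair\<close>.\<close>

lemma expect_prod_touched:
  assumes "finite E" "\<And>e. e \<in> E \<Longrightarrow> \<exists>x y. e = {x, y}"
    and fair: "p * a + (1 - p) * b = 1"
  shows "expect p E (\<lambda>S. \<Prod>e\<in>touched E S X. if e \<in> S then a else b) = 1"
proof (induction E X rule: exploration_induct)
  case finite
  show ?case by fact
next
  case edges
  then show ?case by fact
next
  case (none E X)
  then have "expect p E (\<lambda>S. \<Prod>e\<in>touched E S X. if e \<in> S then a else b) = expect p E (\<lambda>S. 1)"
    by (intro expect_cong) (simp add: touched_none)
  with none show ?case by simp
next
  case (step E X e x y)
  have fin: "finite (touched E S Y)" "e \<notin> touched E S Y" for S Y
    using step(1,2) by (auto simp: touched_def)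
  have "expect p E (\<lambda>S. \<Prod>d\<in>touched (insert e E) (insert e S) X. if d \<in> insert e S then a else b)
      = expect p E (\<lambda>S. a * (\<Prod>d\<in>touched E S (X \<union> e). if d \<in> S then a else b))"
  proof (intro expect_cong)
    fix S
    have "(\<Prod>d\<in>touched E S (X \<union> e). if d \<in> insert e S then a else b)
        = (\<Prod>d\<in>touched E S (X \<union> e). if d \<in> S then a else b)"
      using fin by (intro prod.cong) auto
    then show "(\<Prod>d\<in>touched (insert e E) (insert e S) X. if d \<in> insert e S then a else b)
        = a * (\<Prod>d\<in>touched E S (X \<union> e). if d \<in> S then a else b)"
      by (simp add: touched_open[OF step(3,4)] fin)
  qed
  moreover have "expect p E (\<lambda>S. \<Prod>d\<in>touched (insert e E) S X. if d \<in> S then a else b)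
      = expect p E (\<lambda>S. b * (\<Prod>d\<in>touched E S X. if d \<in> S then a else b))"
    using step(2) by (intro expect_cong) (auto simp: touched_closed[OF step(3,4)] fin)
  ultimately show ?case
    using step fair by (simp add: expect_insert expect_cmult)
qed

text \<open>Wald's identity for the same exploration: each revealed edge adds a term of conditional
  mean zero.\<close>

lemma expect_sum_touched:
  assumes "finite E" "\<And>e. e \<in> E \<Longrightarrow> \<exists>x y. e = {x, y}"
  shows "expect p E (\<lambda>S. \<Sum>e\<in>touched E S X. of_bool (e \<in> S) - p) = 0"
proof (induction E X rule: exploration_induct)
  case finite
  show ?case by fact
next
  case edges
  then show ?case by fact
next
  case (none E X)
  then have "expect p E (\<lambda>S. \<Sum>e\<in>touched E S X. of_bool (e \<in> S) - p) = expect p E (\<lambda>S. 0)"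
    by (intro expect_cong) (simp add: touched_none)
  with none show ?case by simp
next
  case (step E X e x y)
  have fin: "finite (touched E S Y)" "e \<notin> touched E S Y" for S Y
    using step(1,2) by (auto simp: touched_def)
  have "expect p E (\<lambda>S. \<Sum>d\<in>touched (insert e E) (insert e S) X. of_bool (d \<in> insert e S) - p)
      = expect p E (\<lambda>S. (1 - p) + (\<Sum>d\<in>touched E S (X \<union> e). of_bool (d \<in> S) - p))"
  proof (intro expect_cong)
    fix S
    have "(\<Sum>d\<in>touched E S (X \<union> e). of_bool (d \<in> insert e S) - p)
        = (\<Sum>d\<in>touched E S (X \<union> e). of_bool (d \<in> S) - p)"
      using fin by (intro sum.cong) auto
    then show "(\<Sum>d\<in>touched (insert e E) (insert e S) X. of_bool (d \<in> insert e S) - p)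
        = (1 - p) + (\<Sum>d\<in>touched E S (X \<union> e). of_bool (d \<in> S) - p)"
      by (simp add: touched_open[OF step(3,4)] fin)
  qed
  moreover have "expect p E (\<lambda>S. \<Sum>d\<in>touched (insert e E) S X. of_bool (d \<in> S) - p)
      = expect p E (\<lambda>S. - p + (\<Sum>d\<in>touched E S X. of_bool (d \<in> S) - p))"
    using step(2) by (intro expect_cong) (auto simp: touched_closed[OF step(3,4)] fin)
  ultimately show ?case
    unfolding expect_insert[OF step(1,2)]
    by (simp only: expect_add expect_const[OF step(1)] step(5,6)) (simp add: algebra_simps)
qed

section \<open>Edges between different boundary clusters\<close>

text \<open>A bridge is automatically closed, since an open edge would link its ends; hence it
  contributes exactly -p to a centred sum over edges.\<close>

definition bridges :: "'a set set \<Rightarrow> 'a set \<Rightarrow> 'a set set \<Rightarrow> 'a set set" where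
  "bridges E B S = {e \<in> E. \<exists>x y. e = {x, y} \<and> two_arms B S x y}"

lemma reach_eq_iff: "reach S {x} = reach S {y} \<longleftrightarrow> linked S x y"
proof
  assume "reach S {x} = reach S {y}"
  then have "y \<in> reach S {x}" using reach_superset[of "{y}" S] by auto
  then show "linked S x y" by (auto simp: reach_def)
next
  assume "linked S x y"
  with linked_sym[OF this] show "reach S {x} = reach S {y}"
    by (auto simp: reach_def intro: rtrancl_trans)
qed

lemma two_arms_commute: "two_arms B S x y \<longleftrightarrow> two_arms B S y x"
  using linked_sym by (fastforce simp: two_arms_def)

text \<open>Each endpoint lies in a single cluster, so an edge meets at most two members of
  \<open>K\<close>, and it meets two precisely when it is a bridge.\<close>

lemma card_clusters_at_edge:
  fixes B :: "'a set" and S :: "'a set set"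
  assumes e: "e \<in> E" "e = {x, y}"
  defines "K \<equiv> (\<lambda>b. reach S {b}) ` B"
  shows "card {C \<in> K. e \<inter> C \<noteq> {}} = of_bool (e \<inter> reach S B \<noteq> {}) + of_bool (e \<in> bridges E B S)"
proof -
  define c where "c z = reach S {z}" for z
  define arm where "arm z \<longleftrightarrow> (\<exists>b\<in>B. linked S z b)" for z
  have c_iff: "c z = c w \<longleftrightarrow> linked S z w" for z w by (simp add: c_def reach_eq_iff)
  have "C \<in> K \<and> e \<inter> C \<noteq> {} \<longleftrightarrow> C \<in> c ` {z \<in> e. arm z}" for C
  proof
    assume "C \<in> K \<and> e \<inter> C \<noteq> {}"
    then obtain b z where bz: "b \<in> B" "C = c b" "z \<in> e" "z \<in> C" by (auto simp: K_def c_def)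
    then have "linked S b z" by (auto simp: c_def reach_def)
    then have "arm z" "c z = C" using bz linked_sym c_iff by (fastforce simp: arm_def)+
    with bz show "C \<in> c ` {z \<in> e. arm z}" by auto
  next
    assume "C \<in> c ` {z \<in> e. arm z}"
    then obtain z b where z: "z \<in> e" "C = c z" "b \<in> B" "linked S z b" by (auto simp: arm_def)
    then have "C = c b" by (simp add: c_iff)
    moreover have "z \<in> C" using z reach_superset[of "{z}" S] by (auto simp: c_def)
    ultimately show "C \<in> K \<and> e \<inter> C \<noteq> {}" using z by (auto simp: K_def c_def)
  qed
  then have 1: "{C \<in> K. e \<inter> C \<noteq> {}} = c ` {z \<in> e. arm z}" by blast
  have 2: "e \<inter> reach S B \<noteq> {} \<longleftrightarrow> arm x \<or> arm y"
    using e linked_sym by (fastforce simp: arm_def reach_def)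
  have 3: "e \<in> bridges E B S \<longleftrightarrow> arm x \<and> arm y \<and> c x \<noteq> c y"
    using e two_arms_commute[of B S]
    by (auto simp: bridges_def two_arms_def arm_def c_iff doubleton_eq_iff)
  have 4: "{z \<in> e. arm z} = (if arm x then {x} else {}) \<union> (if arm y then {y} else {})"
    using e by auto
  show ?thesis
    unfolding 1 2 3 4 by auto
qed

text \<open>The sum over the clusters meeting \<open>B\<close> counts every bridge twice, the exploration of all of
  them together counts it once; since the latter has mean zero, the mean number of bridges is
  governed by the fluctuations around individual clusters.\<close>

lemma expect_card_bridges:
  fixes p t :: real
  assumes p: "0 < p" "p < 1" and t: "0 < t" "t \<le> 1 / 2"
    and E: "finite E" "\<And>e. e \<in> E \<Longrightarrow> \<exists>x y. e = {x, y}" and B: "finite B"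
  shows "p * expect p E (\<lambda>S. card (bridges E B S)) \<le> card B / t + 4 * t * card E"
proof -
  define g :: "'a set set \<Rightarrow> 'a set \<Rightarrow> real" where "g S e = of_bool (e \<in> S) - p" for S e
  \<comment> \<open>Both factors equal \<open>1 - t * g S e\<close>, and their average with weights
    p and 1 - p is 1. To first order in \<open>t\<close> the product is the exponential of -t times
    the sum of \<open>g\<close> over the explored edges, but its mean is exactly one.\<close>
  define W where "W S X = (\<Prod>e\<in>touched E S X. if e \<in> S then 1 - t * (1 - p) else 1 + t * p)" for S X
  have EW: "expect p E (\<lambda>S. W S X) = 1" for X
    unfolding W_def by (rule expect_prod_touched[OF E]) (auto simp: algebra_simps)
  have pointwise: "p * card (bridges E B S) \<le> (\<Sum>e\<in>touched E S B. g S e)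
      + ((1 / t) * (\<Sum>b\<in>B. W S {b}) + 4 * t * card E)" if S: "S \<subseteq> E" for S
  proof -
    define K where "K = (\<lambda>b. reach S {b}) ` B"
    define inc where "inc C = {e \<in> E. e \<inter> C \<noteq> {}}" for C
    have fin: "finite K" "finite (inc C)" for C using B E by (auto simp: K_def inc_def)
    have count: "card {C \<in> K. e \<inter> C \<noteq> {}} = of_bool (e \<inter> reach S B \<noteq> {}) + of_bool (e \<in> bridges E B S)"
      if "e \<in> E" for e
      unfolding K_def using E(2)[OF that] card_clusters_at_edge[OF that] by blast
    have swap: "(\<Sum>C\<in>K. \<Sum>e\<in>inc C. f e) = (\<Sum>e\<in>E. card {C \<in> K. e \<inter> C \<noteq> {}} * f e)" for f :: "'a set \<Rightarrow> real"
      unfolding inc_def using fin E by (subst sum.swap_restrict) auto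
    have nb: "e \<notin> S" if "e \<in> bridges E B S" for e
      using that by (auto simp: bridges_def two_arms_def linked_edge)
    have fb: "finite (bridges E B S)" using E by (auto simp: bridges_def)
    have "(\<Sum>C\<in>K. \<Sum>e\<in>inc C. g S e) = (\<Sum>e\<in>E. of_bool (e \<inter> reach S B \<noteq> {}) * g S e)
        + (\<Sum>e\<in>E. of_bool (e \<in> bridges E B S) * g S e)"
      unfolding swap sum.distrib[symmetric] by (intro sum.cong) (auto simp: count algebra_simps)
    also have "(\<Sum>e\<in>E. of_bool (e \<inter> reach S B \<noteq> {}) * g S e) = (\<Sum>e\<in>touched E S B. g S e)"
      unfolding touched_def using E by (intro sum.mono_neutral_cong_right) auto
    also have "(\<Sum>e\<in>E. of_bool (e \<in> bridges E B S) * g S e) = (\<Sum>e\<in>E. if e \<in> bridges E B S then - p else 0)"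
      using nb by (intro sum.cong) (auto simp: g_def)
    also have "\<dots> = (\<Sum>e\<in>bridges E B S. - p)"
      using E by (subst sum.inter_filter[symmetric]) (auto simp: bridges_def intro!: sum.cong)
    finally have total: "(\<Sum>C\<in>K. \<Sum>e\<in>inc C. g S e) = (\<Sum>e\<in>touched E S B. g S e) - p * card (bridges E B S)"
      by simp
    define w where "w C = (\<Prod>e\<in>inc C. if e \<in> S then 1 - t * (1 - p) else 1 + t * p)" for C
    have factor: "0 < (if e \<in> S then 1 - t * (1 - p) else 1 + t * p)"
       "- t * g S e - 2 * t\<^sup>2 \<le> ln (if e \<in> S then 1 - t * (1 - p) else 1 + t * p)" for e
    proof -
      have gb: "\<bar>t * g S e\<bar> \<le> t" using t p by (auto simp: g_def abs_mult)
      have eq: "(if e \<in> S then 1 - t * (1 - p) else 1 + t * p) = 1 + - (t * g S e)"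
        by (simp add: g_def)
      show "0 < (if e \<in> S then 1 - t * (1 - p) else 1 + t * p)" using gb t unfolding eq by linarith
      \<comment> \<open>The second-order bound \<open>ln (1 - a) \<ge> - a - 2 * a\<^sup>2\<close>
        for \<open>a\<close> of modulus at most 1/2, whence \<open>t \<le> 1 / 2\<close>. The
        constant 2 later becomes 4 because an edge meets at most two clusters.\<close>
      have "ln (1 + - (t * g S e)) \<ge> - (t * g S e) - 2 * (t * g S e)\<^sup>2"
      proof (cases "t * g S e \<ge> 0")
        case True
        moreover have "t * g S e \<le> 1 / 2" using gb t by linarith
        ultimately show ?thesis using ln_one_minus_pos_lower_bound[of "t * g S e"] by simp
      next
        case False
        moreover have "- (t * g S e) \<le> 1" using gb t by linarith
        ultimately have "- (t * g S e) - (t * g S e)\<^sup>2 \<le> ln (1 + - (t * g S e))"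
          using ln_one_plus_pos_lower_bound[of "- (t * g S e)"] by (simp only: power2_minus)
        with zero_le_power2[of "t * g S e"] show ?thesis by linarith
      qed
      moreover have "(t * g S e)\<^sup>2 \<le> t\<^sup>2" using gb by (simp add: abs_le_square_iff[symmetric])
      ultimately show "- t * g S e - 2 * t\<^sup>2 \<le> ln (if e \<in> S then 1 - t * (1 - p) else 1 + t * p)"
        unfolding eq by linarith
    qed
    have single: "- (\<Sum>e\<in>inc C. g S e) \<le> (1 / t) * w C + 2 * t * card (inc C)" for C
    proof -
      have pos: "0 < w C" unfolding w_def using factor(1) by (intro prod_pos) auto
      have "(\<Sum>e\<in>inc C. - t * g S e - 2 * t\<^sup>2) \<le> (\<Sum>e\<in>inc C. ln (if e \<in> S then 1 - t * (1 - p) else 1 + t * p))"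
        using factor(2) by (intro sum_mono) auto
      also have "\<dots> = ln (w C)"
        unfolding w_def using factor(1) fin by (intro ln_prod[symmetric]) (auto simp: less_le)
      \<comment> \<open>The crude bound \<open>ln w \<le> w\<close> makes the estimate linear in the
        weights, whose means are given by \<open>EW\<close>.\<close>
      also have "\<dots> \<le> w C" using ln_le_minus_one[OF pos] by simp
      finally have "t * - (\<Sum>e\<in>inc C. g S e) - 2 * t\<^sup>2 * card (inc C) \<le> w C"
        by (simp add: sum_subtractf sum_distrib_left[symmetric] sum_negf mult.commute)
      then show ?thesis using t by (simp add: field_simps power2_eq_square)
    qed
    have "(\<Sum>C\<in>K. - (\<Sum>e\<in>inc C. g S e)) \<le> (\<Sum>C\<in>K. (1 / t) * w C + 2 * t * card (inc C))"
      by (intro sum_mono single)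
    also have "\<dots> = (1 / t) * (\<Sum>C\<in>K. w C) + 2 * t * (\<Sum>C\<in>K. card (inc C))"
      by (simp add: sum.distrib sum_distrib_left)
    finally have clusters: "(\<Sum>C\<in>K. - (\<Sum>e\<in>inc C. g S e))
        \<le> (1 / t) * (\<Sum>C\<in>K. w C) + 2 * t * (\<Sum>C\<in>K. card (inc C))" .
    \<comment> \<open>Several vertices of \<open>B\<close> may share a cluster, so the right-hand
      side overcounts. This is harmless because the weights are nonnegative; the centred sums, which
      change sign, could not be treated so. In return the index set is no longer random and the
      expectation can be taken termwise.\<close>
    have weights: "(\<Sum>C\<in>K. w C) \<le> (\<Sum>b\<in>B. W S {b})"
    proof -
      have "0 \<le> w C" for C unfolding w_def using factor(1) by (intro prod_nonneg) (auto simp: less_imp_le)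
      then have "(\<Sum>C\<in>K. w C) \<le> (\<Sum>b\<in>B. w (reach S {b}))"
        unfolding K_def using sum_image_le[OF B, of w "\<lambda>b. reach S {b}"] by (simp add: o_def)
      then show ?thesis by (simp add: w_def W_def inc_def touched_def)
    qed
    have sizes: "real (\<Sum>C\<in>K. card (inc C)) \<le> 2 * card E"
    proof -
      have "real (\<Sum>C\<in>K. card (inc C)) = (\<Sum>C\<in>K. \<Sum>e\<in>inc C. 1)" by simp
      also have "\<dots> = (\<Sum>e\<in>E. real (card {C \<in> K. e \<inter> C \<noteq> {}}) * 1)" by (rule swap)
      also have "\<dots> \<le> (\<Sum>e\<in>E. 2)" by (intro sum_mono) (auto simp: count)
      finally show ?thesis by simp
    qed
    have "(1 / t) * (\<Sum>C\<in>K. w C) \<le> (1 / t) * (\<Sum>b\<in>B. W S {b})"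
      using weights t by (intro mult_left_mono) auto
    moreover have "2 * t * real (\<Sum>C\<in>K. card (inc C)) \<le> 2 * t * (2 * card E)"
      using sizes t by (intro mult_left_mono) auto
    ultimately show ?thesis using clusters total by (simp add: sum_negf)
  qed
  have "expect p E (\<lambda>S. p * card (bridges E B S)) \<le> expect p E (\<lambda>S. (\<Sum>e\<in>touched E S B. g S e)
      + ((1 / t) * (\<Sum>b\<in>B. W S {b}) + 4 * t * card E))"
    using p by (intro expect_mono pointwise) auto
  also have "\<dots> = 0 + ((1 / t) * (\<Sum>b\<in>B. 1) + 4 * t * card E)"
    using E(1) expect_sum_touched[OF E, of p B]
    by (simp only: expect_add expect_cmult expect_sum EW expect_const g_def)
  finally show ?thesis by (simp add: expect_cmult)
qed

text \<open>Finite energy: if \<open>x\<close> and \<open>y\<close> lie in different far-reaching clusters, opening the edges of a path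
  between them one after the other must at some moment open a bridge.\<close>

lemma two_arms_step:
  assumes "two_arms B S x y" "e = {x, z}"
  shows "two_arms B S x z \<or> two_arms B (insert e S) z y"
proof (cases "linked (insert e S) x y")
  \<comment> \<open>A connection from \<open>x\<close> to \<open>y\<close> through the new edge
    forces \<open>linked S z y\<close>, so \<open>x\<close> and \<open>z\<close> had separate arms
    already.\<close>
  case True
  then have "y \<in> reach S ({x} \<union> e)"
    using reach_insert_edge[OF assms(2), of "{x}" S] by (auto simp: reach_def)
  with assms have zy: "linked S z y" by (auto simp: reach_def two_arms_def)
  have "\<not> linked S x z" using assms(1) zy rtrancl_trans[of x z _ y] by (auto simp: two_arms_def)
  moreover obtain b where "b \<in> B" "linked S z b"
    using assms(1) zy rtrancl_trans[of z y] by (auto simp: two_arms_def)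
  ultimately show ?thesis using assms(1) by (auto simp: two_arms_def)
next
  \<comment> \<open>With \<open>e\<close> open, \<open>z\<close> inherits the arm of
    \<open>x\<close> and stays separated from \<open>y\<close>.\<close>
  case False
  have m: "linked (insert e S) u v" if "linked S u v" for u v
    using that by (rule linked_mono) auto
  have zx: "linked (insert e S) z x" "linked (insert e S) x z"
    using assms(2) by (auto intro!: linked_edge simp: insert_commute)
  have "\<not> linked (insert e S) z y" using False rtrancl_trans[OF zx(2)] by blast
  moreover obtain b c where "b \<in> B" "linked (insert e S) z b" "c \<in> B" "linked (insert e S) y c"
    using assms(1) m zx unfolding two_arms_def by (metis rtrancl_trans)
  ultimately show ?thesis by (auto simp: two_arms_def)
qed

section \<open>Percolation on countable graphs\<close>

text \<open>Passage from the product measure to finite sums: an event decided by the finitely many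
  edges of \<open>F\<close> is the disjoint union of the cylinders \<open>A S\<close>, one for each
  admissible pattern of open edges in \<open>F\<close>.\<close>

lemma
  fixes I :: "'e set" and p :: real
  assumes p: "0 \<le> p" "p \<le> 1" and F: "finite F" "F \<subseteq> I"
  defines "M \<equiv> Pi\<^sub>M I (\<lambda>_. measure_pmf (bernoulli_pmf p))"
  shows sets_finite_dim: "{\<omega> \<in> space M. Q {e \<in> F. \<omega> e}} \<in> sets M"
    and measure_finite_dim: "measure M {\<omega> \<in> space M. Q {e \<in> F. \<omega> e}} = prb p F Q"
proof -
  interpret product_prob_space "\<lambda>_::'e. measure_pmf (bernoulli_pmf p)" I
    by unfold_locales
  define A where "A S = {\<omega> \<in> space M. {e \<in> F. \<omega> e} = S}" for S
  have A: "A S = prod_emb I (\<lambda>_. measure_pmf (bernoulli_pmf p)) F (\<Pi>\<^sub>E e\<in>F. {e \<in> S})"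
    if "S \<subseteq> F" for S
    using that F unfolding A_def M_def prod_emb_def space_PiM
    by (auto simp: PiE_iff restrict_def extensional_def fun_eq_iff)
  have sets: "A S \<in> sets M" if "S \<subseteq> F" for S
    unfolding A[OF that] unfolding M_def using F by (intro sets_PiM_I) auto
  have meas: "measure M (A S) = (\<Prod>e\<in>F. if e \<in> S then p else 1 - p)" if "S \<subseteq> F" for S
    unfolding A[OF that] unfolding M_def using F p
    by (subst measure_PiM_emb) (auto simp: measure_pmf_single intro!: prod.cong)
  have ev: "{\<omega> \<in> space M. Q {e \<in> F. \<omega> e}} = (\<Union>S\<in>{S \<in> Pow F. Q S}. A S)"
    by (auto simp: A_def)
  show "{\<omega> \<in> space M. Q {e \<in> F. \<omega> e}} \<in> sets M"
    unfolding ev using F sets by (intro sets.finite_UN) auto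
  have "measure M {\<omega> \<in> space M. Q {e \<in> F. \<omega> e}} = (\<Sum>S\<in>{S \<in> Pow F. Q S}. measure M (A S))"
    unfolding ev using F sets
    by (intro P.finite_measure_finite_Union[folded M_def]) (auto simp: disjoint_family_on_def A_def)
  also have "\<dots> = (\<Sum>S\<in>{S \<in> Pow F. Q S}. (\<Prod>e\<in>F. if e \<in> S then p else 1 - p))"
    using meas by (intro sum.cong) auto
  also have "\<dots> = prb p F Q"
    unfolding expect_def using F by (intro sum.mono_neutral_cong_left) auto
  finally show "measure M {\<omega> \<in> space M. Q {e \<in> F. \<omega> e}} = prb p F Q" .
qed

lemma connection_event_eq:
  "connection_event p H u v = {\<omega> \<in> space (percolation p H). linked {e \<in> edges H. \<omega> e} u v}"
  by (simp add: connection_event_def path_iff_linked open_edges_def)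

lemma linked_incseq:
  assumes F: "incseq F" and "linked (\<Union>n. F n) u v"
  obtains n where "linked (F n) u v"
proof -
  from assms(2) have "\<exists>n. linked (F n) u v"
  proof (induction rule: rtrancl_induct)
    case (step y z)
    then obtain m n where mn: "linked (F m) u y" "{y, z} \<in> F n" by (auto simp: adjacency_def)
    have "linked (F (max m n)) u y"
      using mn(1) by (rule linked_mono) (use F in \<open>auto simp: incseq_def\<close>)
    moreover have "{y, z} \<in> F (max m n)"
      using mn(2) F[unfolded incseq_def, rule_format, of n "max m n"] by auto
    ultimately have "linked (F (max m n)) u z"
      by (auto simp: adjacency_def intro: rtrancl_into_rtrancl)
    then show ?case ..
  qed auto
  then show ?thesis using that by blast
qed

text \<open>Continuity from below: an open path has finitely many edges and so appears at a finite
  stage of the exhaustion.\<close>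

lemma connection_prob_limit:
  assumes p: "0 \<le> p" "p \<le> 1"
    and F: "incseq F" "\<And>n. finite (F n)" "(\<Union>n. F n) = edges H"
  shows "(\<lambda>n. prb p (F n) (\<lambda>S. linked S u v)) \<longlonglongrightarrow> connection_prob p H u v"
proof -
  interpret product_prob_space "\<lambda>_. measure_pmf (bernoulli_pmf p)" "edges H"
    by unfold_locales
  let ?M = "percolation p H"
  define A where "A n = {\<omega> \<in> space ?M. linked {e \<in> F n. \<omega> e} u v}" for n
  have FH: "F n \<subseteq> edges H" for n using F(3) by auto
  have "connection_event p H u v = (\<Union>n. A n)"
  proof (intro equalityI subsetI)
    fix \<omega> assume "\<omega> \<in> connection_event p H u v"
    then have \<omega>: "\<omega> \<in> space ?M" "linked (\<Union>n. {e \<in> F n. \<omega> e}) u v"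
      unfolding connection_event_eq F(3)[symmetric]
      by (auto elim!: back_subst[of "\<lambda>F. linked F u v"])
    have "incseq (\<lambda>n. {e \<in> F n. \<omega> e})" using F(1) by (auto simp: incseq_def)
    from linked_incseq[OF this \<omega>(2)] obtain n where "linked {e \<in> F n. \<omega> e} u v" .
    with \<omega> show "\<omega> \<in> (\<Union>n. A n)" by (auto simp: A_def)
  next
    fix \<omega> assume "\<omega> \<in> (\<Union>n. A n)"
    then obtain n where n: "\<omega> \<in> space ?M" "linked {e \<in> F n. \<omega> e} u v" by (auto simp: A_def)
    from n(2) have "linked {e \<in> edges H. \<omega> e} u v" by (rule linked_mono) (use FH in auto)
    with n show "\<omega> \<in> connection_event p H u v" by (simp add: connection_event_eq)
  qed
  moreover have "incseq A"
    using F(1) unfolding A_def incseq_def by (auto elim!: linked_mono)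
  moreover have "range A \<subseteq> sets ?M"
    using sets_finite_dim[OF p F(2) FH, of "\<lambda>S. linked S u v"] by (auto simp: A_def percolation_def)
  ultimately have "(\<lambda>n. measure ?M (A n)) \<longlonglongrightarrow> connection_prob p H u v"
    unfolding connection_prob_def
    using P.finite_Lim_measure_incseq[folded percolation_def, of A] by simp
  moreover have "measure ?M (A n) = prb p (F n) (\<lambda>S. linked S u v)" for n
    unfolding A_def percolation_def by (rule measure_finite_dim[OF p F(2) FH])
  ultimately show ?thesis by simp
qed

lemma connection_prob_finite:
  assumes "0 \<le> p" "p \<le> 1" "finite (edges H)"
  shows "connection_prob p H u v = prb p (edges H) (\<lambda>S. linked S u v)"
  using connection_prob_limit[of p "\<lambda>_. edges H" H u v] assms
  by (simp add: LIMSEQ_const_iff)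

lemma prb_subset_mono:
  assumes "0 \<le> p" "p \<le> 1" "finite E" "F \<subseteq> E"
    and "\<And>S. S \<subseteq> E \<Longrightarrow> Q (S \<inter> F) \<Longrightarrow> R S"
  shows "prb p F Q \<le> prb p E R"
  using prb_mono[of p E "\<lambda>S. Q (S \<inter> F)" R] expect_restrict[of E F p "\<lambda>S. of_bool (Q S)"] assms
  by simp

lemma connection_prob_lower:
  assumes p: "0 \<le> p" "p \<le> 1" and H: "countable (edges H)" and F: "finite F" "F \<subseteq> edges H"
  shows "prb p F (\<lambda>S. linked S u v) \<le> connection_prob p H u v"
proof -
  \<comment> \<open>An exhaustion by finite sets containing \<open>F\<close> from the start, so
    every term of the limit dominates the probability on \<open>F\<close>.\<close>
  define E where "E n = F \<union> {e \<in> edges H. to_nat_on (edges H) e < n}" for n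
  have fin: "finite (E n)" for n
  proof -
    have "finite {e \<in> edges H. to_nat_on (edges H) e < n}"
      using inj_on_to_nat_on[OF H]
      by (intro finite_imageD[of "to_nat_on (edges H)"]) (auto intro: finite_subset[of _ "{..<n}"] elim: inj_on_subset)
    with F show ?thesis by (simp add: E_def)
  qed
  have "(\<lambda>n. prb p (E n) (\<lambda>S. linked S u v)) \<longlonglongrightarrow> connection_prob p H u v"
    using F fin by (intro connection_prob_limit p) (auto simp: E_def incseq_def)
  then show ?thesis
    using F fin by (intro LIMSEQ_le_const) (auto intro!: prb_subset_mono[OF p] elim: linked_mono simp: E_def)
qed

text \<open>Here \<open>f\<close> identifies a box with an induced subgraph that can be left only
  through the image of \<open>B\<close>. Both bounds mention the box alone, which makes different
  graphs containing the same box comparable. For the upper bound, a connection in \<open>H\<close>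
  that is not realised inside the box must leave it; following it from either end gives the two
  arms.\<close>

lemma connection_prob_box:
  assumes p: "0 \<le> p" "p \<le> 1" and H: "countable (edges H)" and E: "finite E" "\<Union>E \<subseteq> L"
    and f: "inj_on f L" and B: "B \<subseteq> L" and uv: "u \<in> L" "v \<in> L"
    and img: "(`) f ` E = {e \<in> edges H. e \<subseteq> f ` L}"
    and interior: "\<And>x z. x \<in> L - B \<Longrightarrow> {f x, z} \<in> edges H \<Longrightarrow> z \<in> f ` L"
  shows "prb p E (\<lambda>S. linked S u v) \<le> connection_prob p H (f u) (f v)"
    and "connection_prob p H (f u) (f v) \<le> prb p E (\<lambda>S. linked S u v) + prb p E (\<lambda>S. two_arms B S u v)"
proof -
  interpret product_prob_space "\<lambda>_. measure_pmf (bernoulli_pmf p)" "edges H"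
    by unfold_locales
  define F where "F = (`) f ` E"
  have F: "finite F" "F \<subseteq> edges H"
    using E(1) unfolding F_def by (rule finite_imageI) (use img in auto)
  have inj: "inj_on ((`) f) E"
    using inj_on_image_Pow[OF f] E(2) by (auto intro: inj_on_subset)
  have transfer: "prb p F Q = prb p E R" if "\<And>S. S \<subseteq> E \<Longrightarrow> Q ((`) f ` S) \<longleftrightarrow> R S" for Q R
    unfolding F_def using that by (subst expect_image[OF inj]) (auto intro!: expect_cong)
  have US: "\<Union>S \<subseteq> L" if "S \<subseteq> E" for S using E(2) that by auto
  have linked: "prb p F (\<lambda>S. linked S (f u) (f v)) = prb p E (\<lambda>S. linked S u v)"
    by (intro transfer linked_image[OF f US] uv)
  have arms: "prb p F (\<lambda>S. two_arms (f ` B) S (f u) (f v)) = prb p E (\<lambda>S. two_arms B S u v)"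
    by (intro transfer two_arms_image[OF f US] uv B)
  show "prb p E (\<lambda>S. linked S u v) \<le> connection_prob p H (f u) (f v)"
    unfolding linked[symmetric] by (rule connection_prob_lower[OF p H F])
  let ?Q = "\<lambda>S. linked S (f u) (f v) \<or> two_arms (f ` B) S (f u) (f v)"
  let ?M = "percolation p H"
  have "connection_event p H (f u) (f v) \<subseteq> {\<omega> \<in> space ?M. ?Q {e \<in> F. \<omega> e}}"
  proof
    fix \<omega> assume "\<omega> \<in> connection_event p H (f u) (f v)"
    then have \<omega>: "\<omega> \<in> space ?M" "linked {e \<in> edges H. \<omega> e} (f u) (f v)"
      by (auto simp: connection_event_eq)
    have eq: "{e \<in> {e \<in> edges H. \<omega> e}. e \<subseteq> f ` L} = {e \<in> F. \<omega> e}"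
      unfolding F_def img by auto
    have nb: "z \<in> f ` L" if "y \<in> f ` L - f ` B" "{y, z} \<in> {e \<in> edges H. \<omega> e}" for y z
      using that interior by auto
    have fuv: "f u \<in> f ` L" "f v \<in> f ` L" using uv by auto
    have "(\<exists>b\<in>f ` B. linked {e \<in> F. \<omega> e} (f u) b) \<or> f v \<in> f ` L \<and> linked {e \<in> F. \<omega> e} (f u) (f v)"
      unfolding eq[symmetric] by (rule linked_leaves[OF \<omega>(2) fuv(1)]) (rule nb)
    moreover have "(\<exists>b\<in>f ` B. linked {e \<in> F. \<omega> e} (f v) b) \<or> f u \<in> f ` L \<and> linked {e \<in> F. \<omega> e} (f v) (f u)"
      unfolding eq[symmetric] by (rule linked_leaves[OF linked_sym[OF \<omega>(2)] fuv(2)]) (rule nb)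
    ultimately have "?Q {e \<in> F. \<omega> e}"
      unfolding two_arms_def using linked_sym[of "f v" "f u" "{e \<in> F. \<omega> e}"] by argo
    with \<omega> show "\<omega> \<in> {\<omega> \<in> space ?M. ?Q {e \<in> F. \<omega> e}}" by simp
  qed
  then have "connection_prob p H (f u) (f v) \<le> measure ?M {\<omega> \<in> space ?M. ?Q {e \<in> F. \<omega> e}}"
    unfolding connection_prob_def using sets_finite_dim[OF p F, of ?Q]
    by (intro P.finite_measure_mono[folded percolation_def]) (auto simp: percolation_def)
  also have "\<dots> = prb p F ?Q"
    unfolding percolation_def by (rule measure_finite_dim[OF p F])
  also have "\<dots> \<le> prb p F (\<lambda>S. linked S (f u) (f v)) + prb p F (\<lambda>S. two_arms (f ` B) S (f u) (f v))"
    by (intro prb_union p) auto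
  finally show "connection_prob p H (f u) (f v)
      \<le> prb p E (\<lambda>S. linked S u v) + prb p E (\<lambda>S. two_arms B S u v)"
    unfolding linked arms .
qed

section \<open>Cubes in the integer lattice\<close>

lemma sum_squares_eq_1_iff:
  fixes a :: "'i \<Rightarrow> int"
  assumes "finite I"
  shows "(\<Sum>i\<in>I. (a i)\<^sup>2) = 1 \<longleftrightarrow> (\<exists>i\<in>I. \<bar>a i\<bar> = 1 \<and> (\<forall>j\<in>I. j \<noteq> i \<longrightarrow> a j = 0))"
proof
  assume one: "(\<Sum>i\<in>I. (a i)\<^sup>2) = 1"
  then obtain i where i: "i \<in> I" "a i \<noteq> 0"
    by (cases "\<forall>i\<in>I. a i = 0") auto
  have split: "(a i)\<^sup>2 + (\<Sum>j\<in>I - {i}. (a j)\<^sup>2) = 1"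
    using one sum.remove[OF assms i(1), of "\<lambda>i. (a i)\<^sup>2"] by simp
  moreover have "0 \<le> (\<Sum>j\<in>I - {i}. (a j)\<^sup>2)" by (intro sum_nonneg) auto
  moreover have "0 < (a i)\<^sup>2" using i by simp
  ultimately have "(a i)\<^sup>2 = 1" "(\<Sum>j\<in>I - {i}. (a j)\<^sup>2) = 0" by linarith+
  then have "\<bar>a i\<bar> = 1" "\<forall>j\<in>I - {i}. a j = 0"
    using assms sum_nonneg_eq_0_iff[of "I - {i}" "\<lambda>i. (a i)\<^sup>2"]
    by (auto simp: power2_eq_1_iff)
  with i show "\<exists>i\<in>I. \<bar>a i\<bar> = 1 \<and> (\<forall>j\<in>I. j \<noteq> i \<longrightarrow> a j = 0)" by blast
next
  assume "\<exists>i\<in>I. \<bar>a i\<bar> = 1 \<and> (\<forall>j\<in>I. j \<noteq> i \<longrightarrow> a j = 0)"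
  then obtain i where i: "i \<in> I" "\<bar>a i\<bar> = 1" "\<forall>j\<in>I. j \<noteq> i \<longrightarrow> a j = 0" by blast
  have "(\<Sum>j\<in>I. (a j)\<^sup>2) = (a i)\<^sup>2 + (\<Sum>j\<in>I - {i}. (a j)\<^sup>2)"
    using assms i(1) by (rule sum.remove)
  also have "(\<Sum>j\<in>I - {i}. (a j)\<^sup>2) = 0" using i by (intro sum.neutral) auto
  also have "(a i)\<^sup>2 = 1" using i(2) by (simp add: power2_eq_1_iff abs_if split: if_splits)
  finally show "(\<Sum>j\<in>I. (a j)\<^sup>2) = 1" by simp
qed

lemma verts_int_lattice [simp]: "verts (int_lattice d) = {..<d} \<rightarrow>\<^sub>E UNIV"
  by (simp add: int_lattice_def)

lemma edges_int_lattice_iff: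
  "{x, y} \<in> edges (int_lattice d) \<longleftrightarrow> x \<in> {..<d} \<rightarrow>\<^sub>E UNIV \<and> y \<in> {..<d} \<rightarrow>\<^sub>E UNIV \<and>
     (\<exists>i<d. \<bar>x i - y i\<bar> = 1 \<and> (\<forall>j<d. j \<noteq> i \<longrightarrow> x j = y j))"
proof -
  have dist: "L2_set (\<lambda>i. real_of_int (x i - y i)) {..<d} = 1 \<longleftrightarrow>
      (\<exists>i<d. \<bar>x i - y i\<bar> = 1 \<and> (\<forall>j<d. j \<noteq> i \<longrightarrow> x j = y j))" for x y :: "nat \<Rightarrow> int"
  proof -
    have "L2_set (\<lambda>i. real_of_int (x i - y i)) {..<d} = sqrt (real_of_int (\<Sum>i<d. (x i - y i)\<^sup>2))"
      by (simp add: L2_set_def)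
    also have "\<dots> = 1 \<longleftrightarrow> (\<Sum>i<d. (x i - y i)\<^sup>2) = 1"
      by (simp only: real_sqrt_eq_1_iff of_int_eq_1_iff)
    also have "\<dots> \<longleftrightarrow> (\<exists>i<d. \<bar>x i - y i\<bar> = 1 \<and> (\<forall>j<d. j \<noteq> i \<longrightarrow> x j = y j))"
      by (subst sum_squares_eq_1_iff) auto
    finally show ?thesis .
  qed
  show ?thesis
    unfolding int_lattice_def sgraph.sel dist
    by (auto simp: doubleton_eq_iff abs_minus_commute)
qed

lemma edge_int_latticeE:
  assumes "e \<in> edges (int_lattice d)"
  obtains x i where "x \<in> {..<d} \<rightarrow>\<^sub>E UNIV" "i < d" "e = {x, x(i := x i + 1)}"
proof -
  obtain x y where e: "e = {x, y}" using assms by (auto simp: int_lattice_def)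
  with assms obtain i where xy: "x \<in> {..<d} \<rightarrow>\<^sub>E UNIV" "y \<in> {..<d} \<rightarrow>\<^sub>E UNIV" "i < d"
     "\<bar>x i - y i\<bar> = 1" "\<forall>j<d. j \<noteq> i \<longrightarrow> x j = y j"
    by (auto simp: edges_int_lattice_iff)
  then have "y = x(i := y i)" "x = y(i := x i)"
    by (auto simp: fun_eq_iff PiE_iff extensional_def) (metis lessThan_iff)+
  moreover have "y i = x i + 1 \<or> x i = y i + 1" using xy(4) by linarith
  ultimately show ?thesis using that[of x i] that[of y i] xy e by (metis insert_commute)
qed

lemma edge_int_latticeI:
  assumes "x \<in> {..<d} \<rightarrow>\<^sub>E UNIV" "i < d"
  shows "{x, x(i := x i + 1)} \<in> edges (int_lattice d)"
  using assms by (auto simp: edges_int_lattice_iff PiE_iff extensional_def intro!: exI[of _ i])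

definition cube :: "nat \<Rightarrow> (nat \<Rightarrow> int) \<Rightarrow> int \<Rightarrow> (nat \<Rightarrow> int) set" where
  "cube d c n = (\<Pi>\<^sub>E i\<in>{..<d}. {c i - n..c i + n})"

definition rim :: "nat \<Rightarrow> (nat \<Rightarrow> int) \<Rightarrow> int \<Rightarrow> (nat \<Rightarrow> int) set" where
  "rim d c n = {x \<in> cube d c n. \<exists>i<d. \<bar>x i - c i\<bar> = n}"

definition cube_edges :: "nat \<Rightarrow> (nat \<Rightarrow> int) \<Rightarrow> int \<Rightarrow> (nat \<Rightarrow> int) set set" where
  "cube_edges d c n = {e \<in> edges (int_lattice d). e \<subseteq> cube d c n}"

lemma in_cube_iff: "x \<in> cube d c n \<longleftrightarrow> x \<in> {..<d} \<rightarrow>\<^sub>E UNIV \<and> (\<forall>i<d. \<bar>x i - c i\<bar> \<le> n)"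
proof -
  have "\<bar>x i - c i\<bar> \<le> n \<longleftrightarrow> c i - n \<le> x i \<and> x i \<le> c i + n" for i by linarith
  then show ?thesis by (auto simp: cube_def PiE_iff)
qed

lemma finite_cube: "finite (cube d c n)"
  by (auto simp: cube_def intro!: finite_PiE)

lemma rim_subset: "rim d c n \<subseteq> cube d c n"
  by (auto simp: rim_def)

lemma finite_cube_edges: "finite (cube_edges d c n)"
  by (rule finite_subset[of _ "Pow (cube d c n)"]) (auto simp: cube_edges_def finite_cube)

lemma Union_cube_edges: "\<Union>(cube_edges d c n) \<subseteq> cube d c n"
  by (auto simp: cube_edges_def)

lemma cube_interior:
  assumes x: "x \<in> cube d c n - rim d c n" and e: "{x, z} \<in> edges (int_lattice d)"
  shows "z \<in> cube d c n"
proof -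
  obtain i where i: "z \<in> {..<d} \<rightarrow>\<^sub>E UNIV" "i < d" "\<bar>x i - z i\<bar> = 1" "\<forall>j<d. j \<noteq> i \<longrightarrow> x j = z j"
    using e by (auto simp: edges_int_lattice_iff)
  have "\<bar>x j - c j\<bar> \<le> n - 1" if "j < d" for j
    using x that by (force simp: rim_def in_cube_iff)
  then have "\<bar>z j - c j\<bar> \<le> n" if "j < d" for j
    using i that by (cases "j = i") (smt (verit))+
  with i show ?thesis by (simp add: in_cube_iff)
qed

definition translate :: "nat \<Rightarrow> (nat \<Rightarrow> int) \<Rightarrow> (nat \<Rightarrow> int) \<Rightarrow> nat \<Rightarrow> int" where
  "translate d c x = (\<lambda>i\<in>{..<d}. x i + c i)"

lemma inj_on_translate: "inj_on (translate d c) ({..<d} \<rightarrow>\<^sub>E UNIV)"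
proof (rule inj_onI)
  fix x y assume xy: "x \<in> {..<d} \<rightarrow>\<^sub>E UNIV" "y \<in> {..<d} \<rightarrow>\<^sub>E UNIV" "translate d c x = translate d c y"
  show "x = y"
  proof (rule PiE_ext[OF xy(1,2)])
    fix i assume "i \<in> {..<d}"
    with fun_cong[OF xy(3), of i] show "x i = y i" by (simp add: translate_def)
  qed
qed

lemma translate_in_verts [simp]: "translate d c x \<in> {..<d} \<rightarrow>\<^sub>E UNIV"
  by (simp add: translate_def)

lemma translate_inverse: "x \<in> {..<d} \<rightarrow>\<^sub>E UNIV \<Longrightarrow> translate d c (translate d (\<lambda>i. - c i) x) = x"
  by (auto simp: translate_def PiE_iff extensional_def fun_eq_iff)

lemma translate_edge_iff:
  assumes "x \<in> {..<d} \<rightarrow>\<^sub>E UNIV" "y \<in> {..<d} \<rightarrow>\<^sub>E UNIV"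
  shows "{translate d c x, translate d c y} \<in> edges (int_lattice d) \<longleftrightarrow> {x, y} \<in> edges (int_lattice d)"
  using assms unfolding edges_int_lattice_iff by (simp add: translate_def cong: conj_cong)

lemma translate_in_cube_iff: "translate d c x \<in> cube d c n \<longleftrightarrow> (\<forall>i<d. \<bar>x i\<bar> \<le> n)"
  by (simp add: in_cube_iff) (simp add: translate_def)

lemma translate_cube: "translate d c ` cube d (\<lambda>_. 0) n = cube d c n"
proof
  show "cube d c n \<subseteq> translate d c ` cube d (\<lambda>_. 0) n"
  proof
    fix x assume x: "x \<in> cube d c n"
    then have "translate d (\<lambda>i. - c i) x \<in> cube d (\<lambda>_. 0) n"
      by (simp add: in_cube_iff) (simp add: translate_def)
    moreover have "translate d c (translate d (\<lambda>i. - c i) x) = x"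
      using x by (intro translate_inverse) (simp add: in_cube_iff)
    ultimately show "x \<in> translate d c ` cube d (\<lambda>_. 0) n" by (metis imageI)
  qed
qed (auto simp: translate_in_cube_iff, simp add: in_cube_iff)

lemma translate_rim: "translate d c ` rim d (\<lambda>_. 0) n = rim d c n"
proof -
  have "(\<exists>i<d. \<bar>translate d c x i - c i\<bar> = n) \<longleftrightarrow> (\<exists>i<d. \<bar>x i\<bar> = n)" for x
    by (auto simp: translate_def)
  then have "rim d c n = {y \<in> translate d c ` cube d (\<lambda>_. 0) n. \<exists>i<d. \<bar>y i - c i\<bar> = n}"
    "x \<in> rim d (\<lambda>_. 0) n \<longleftrightarrow> x \<in> cube d (\<lambda>_. 0) n \<and> (\<exists>i<d. \<bar>translate d c x i - c i\<bar> = n)" for x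
    by (simp_all add: rim_def translate_cube)
  then show ?thesis by fast
qed

lemma translate_cube_edges: "(`) (translate d c) ` cube_edges d (\<lambda>_. 0) n = cube_edges d c n"
proof (intro equalityI subsetI)
  fix e assume "e \<in> (`) (translate d c) ` cube_edges d (\<lambda>_. 0) n"
  then obtain a where a: "a \<in> edges (int_lattice d)" "a \<subseteq> cube d (\<lambda>_. 0) n" "e = translate d c ` a"
    by (auto simp: cube_edges_def)
  then obtain x y where xy: "a = {x, y}" by (elim edge_int_latticeE)
  with a have "x \<in> {..<d} \<rightarrow>\<^sub>E UNIV" "y \<in> {..<d} \<rightarrow>\<^sub>E UNIV" by (auto simp: in_cube_iff)
  with a xy have "e \<in> edges (int_lattice d)" by (simp add: translate_edge_iff)
  moreover have "e \<subseteq> cube d c n" using a translate_cube[of d c n] by auto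
  ultimately show "e \<in> cube_edges d c n" by (simp add: cube_edges_def)
next
  fix e assume "e \<in> cube_edges d c n"
  then have e: "e \<in> edges (int_lattice d)" "e \<subseteq> translate d c ` cube d (\<lambda>_. 0) n"
    by (auto simp: cube_edges_def translate_cube)
  obtain a b where ab: "e = {a, b}" using e(1) by (elim edge_int_latticeE)
  with e(2) obtain x y where "a = translate d c x" "b = translate d c y"
    and xy: "x \<in> cube d (\<lambda>_. 0) n" "y \<in> cube d (\<lambda>_. 0) n"
    by auto
  with ab have eq: "e = {translate d c x, translate d c y}" by simp
  with e xy have "{x, y} \<in> cube_edges d (\<lambda>_. 0) n"
    by (auto simp: cube_edges_def translate_edge_iff in_cube_iff)
  then show "e \<in> (`) (translate d c) ` cube_edges d (\<lambda>_. 0) n"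
    unfolding eq by (auto intro!: image_eqI[of _ _ "{x, y}"])
qed

section \<open>Two-arm probabilities: translation invariance and passage to smaller cubes\<close>

definition cube_arms :: "real \<Rightarrow> nat \<Rightarrow> int \<Rightarrow> (nat \<Rightarrow> int) \<Rightarrow> (nat \<Rightarrow> int) \<Rightarrow> real" where
  "cube_arms p d n x y = prb p (cube_edges d (\<lambda>_. 0) n) (\<lambda>S. two_arms (rim d (\<lambda>_. 0) n) S x y)"

lemma cube_arms_translate:
  assumes "x \<in> cube d (\<lambda>_. 0) n" "y \<in> cube d (\<lambda>_. 0) n"
  shows "prb p (cube_edges d c n) (\<lambda>S. two_arms (rim d c n) S (translate d c x) (translate d c y)) = cube_arms p d n x y"
proof -
  have inj: "inj_on (translate d c) (cube d (\<lambda>_. 0) n)"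
    using inj_on_translate by (rule inj_on_subset) (auto simp: in_cube_iff)
  have inj': "inj_on ((`) (translate d c)) (cube_edges d (\<lambda>_. 0) n)"
    using inj_on_image_Pow[OF inj] by (rule inj_on_subset) (auto simp: cube_edges_def)
  have "two_arms (rim d c n) ((`) (translate d c) ` S) (translate d c x) (translate d c y)
      \<longleftrightarrow> two_arms (rim d (\<lambda>_. 0) n) S x y" if "S \<subseteq> cube_edges d (\<lambda>_. 0) n" for S
  proof -
    have "\<Union>S \<subseteq> cube d (\<lambda>_. 0) n" using that Union_cube_edges by blast
    from two_arms_image[OF inj this assms rim_subset] show ?thesis
      by (simp only: translate_rim)
  qed
  then have "prb p ((`) (translate d c) ` cube_edges d (\<lambda>_. 0) n)
      (\<lambda>S. two_arms (rim d c n) S (translate d c x) (translate d c y)) = cube_arms p d n x y"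
    unfolding cube_arms_def expect_image[OF inj'] by (intro expect_cong) simp
  then show ?thesis by (simp only: translate_cube_edges)
qed

text \<open>An arm to the outer rim crosses the inner rim, and removing edges cannot link separated
  points. The strict inequality in \<open>far\<close> keeps the outer rim disjoint from the small
  cube.\<close>

lemma cube_arms_le:
  assumes p: "0 \<le> p" "p \<le> 1" and far: "\<And>j. j < d \<Longrightarrow> \<bar>c j\<bar> + n < m"
    and xy: "x \<in> cube d c n" "y \<in> cube d c n"
  shows "cube_arms p d m x y \<le> prb p (cube_edges d c n) (\<lambda>S. two_arms (rim d c n) S x y)"
proof -
  have sub: "cube d c n \<subseteq> cube d (\<lambda>_. 0) m"
    using far by (fastforce simp: in_cube_iff)
  then have sub': "cube_edges d c n \<subseteq> cube_edges d (\<lambda>_. 0) m" by (auto simp: cube_edges_def)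
  have disj: "z \<notin> cube d c n" if "z \<in> rim d (\<lambda>_. 0) m" for z
  proof
    assume z: "z \<in> cube d c n"
    from that obtain i where "i < d" "\<bar>z i\<bar> = m" by (auto simp: rim_def)
    with z far[of i] have "\<bar>z i - c i\<bar> \<le> n" "\<bar>c i\<bar> + n < m" by (auto simp: in_cube_iff)
    with \<open>\<bar>z i\<bar> = m\<close> show False by linarith
  qed
  have "two_arms (rim d c n) (S \<inter> cube_edges d c n) x y"
    if S: "S \<subseteq> cube_edges d (\<lambda>_. 0) m" and arms: "two_arms (rim d (\<lambda>_. 0) m) S x y" for S
  proof -
    have eq: "{e \<in> S. e \<subseteq> cube d c n} = S \<inter> cube_edges d c n"
      using S by (auto simp: cube_edges_def)
    have nb: "z \<in> cube d c n" if "w \<in> cube d c n - rim d c n" "{w, z} \<in> S" for w z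
      using cube_interior[OF that(1)] that(2) S by (auto simp: cube_edges_def)
    have "\<exists>b\<in>rim d c n. linked (S \<inter> cube_edges d c n) w b"
      if w: "w \<in> cube d c n" "\<exists>b\<in>rim d (\<lambda>_. 0) m. linked S w b" for w
    proof -
      obtain z where z: "z \<notin> cube d c n" "linked S w z" using w(2) disj by blast
      have "(\<exists>b\<in>rim d c n. linked (S \<inter> cube_edges d c n) w b)
          \<or> z \<in> cube d c n \<and> linked (S \<inter> cube_edges d c n) w z"
        unfolding eq[symmetric] by (rule linked_leaves[OF z(2) w(1)]) (rule nb)
      with z show ?thesis by simp
    qed
    moreover have "\<not> linked (S \<inter> cube_edges d c n) x y"
      using arms linked_mono[of x y "S \<inter> cube_edges d c n" S] by (auto simp: two_arms_def)
    ultimately show ?thesis using arms xy by (simp add: two_arms_def)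
  qed
  then have "cube_arms p d m x y \<le> prb p (cube_edges d (\<lambda>_. 0) m)
      (\<lambda>S. two_arms (rim d c n) (S \<inter> cube_edges d c n) x y)"
    unfolding cube_arms_def by (intro prb_mono p) auto
  also have "\<dots> = prb p (cube_edges d c n) (\<lambda>S. two_arms (rim d c n) S x y)"
    by (rule expect_restrict[OF finite_cube_edges sub'])
  finally show ?thesis .
qed

section \<open>Two arms in large cubes\<close>

text \<open>Serves two counts: pairs of opposite faces of a cube, and positions of an edge of
  direction \<open>i\<close> inside it.\<close>

lemma card_PiE_one_coordinate:
  assumes "i < d"
  shows "card (\<Pi>\<^sub>E j\<in>{..<d}. if j = i then A else C) = card A * card C ^ (d - 1)"
proof -
  have "card (\<Pi>\<^sub>E j\<in>{..<d}. if j = i then A else C) = (\<Prod>j\<in>{..<d}. card (if j = i then A else C))"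
    by (simp add: card_PiE)
  also have "\<dots> = card A * (\<Prod>j\<in>{..<d} - {i}. card (if j = i then A else C))"
    using assms by (subst prod.remove[of _ i]) auto
  also have "(\<Prod>j\<in>{..<d} - {i}. card (if j = i then A else C)) = (\<Prod>j\<in>{..<d} - {i}. card C)"
    by (intro prod.cong) auto
  also have "\<dots> = card C ^ (d - 1)" using assms by simp
  finally show ?thesis .
qed

lemma card_cube: "card (cube d (\<lambda>_. 0) (int n)) = (2 * n + 1) ^ d"
  by (simp add: cube_def card_PiE nat_add_distrib nat_mult_distrib)

text \<open>Union bound over the \<open>d\<close> pairs of opposite faces. The surface order, one
  power of \<open>n\<close> below the volume, is what leaves room for the choice of
  \<open>t\<close>.\<close>

lemma card_rim: "card (rim d (\<lambda>_. 0) (int n)) \<le> d * (2 * (2 * n + 1) ^ (d - 1))"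
proof -
  let ?P = "\<lambda>i. \<Pi>\<^sub>E j\<in>{..<d}. if j = i then {- int n, int n} else {- int n..int n}"
  have "rim d (\<lambda>_. 0) (int n) \<subseteq> (\<Union>i<d. ?P i)"
  proof
    fix x assume "x \<in> rim d (\<lambda>_. 0) (int n)"
    then obtain i where i: "i < d" "\<bar>x i\<bar> = int n" and x: "x \<in> cube d (\<lambda>_. 0) (int n)"
      by (auto simp: rim_def)
    then have "x \<in> ?P i" by (auto simp: cube_def PiE_iff abs_if split: if_splits)
    with i show "x \<in> (\<Union>i<d. ?P i)" by blast
  qed
  moreover have "finite (\<Union>i<d. ?P i)" by (auto intro!: finite_PiE)
  ultimately have "card (rim d (\<lambda>_. 0) (int n)) \<le> card (\<Union>i<d. ?P i)" by (intro card_mono)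
  also have "\<dots> \<le> (\<Sum>i<d. card (?P i))" by (rule card_UN_le) simp
  also have "\<dots> \<le> (\<Sum>i<d. 2 * (2 * n + 1) ^ (d - 1))"
  proof (rule sum_mono)
    fix i assume "i \<in> {..<d}"
    \<comment> \<open>An inequality only, as opposite faces coincide for
      \<open>n = 0\<close>.\<close>
    moreover have "card {- int n, int n} \<le> 2" by (simp add: card_insert_if)
    ultimately show "card (?P i) \<le> 2 * (2 * n + 1) ^ (d - 1)"
      by (subst card_PiE_one_coordinate) (auto simp: nat_add_distrib nat_mult_distrib intro: mult_right_mono)
  qed
  finally show ?thesis by simp
qed

lemma card_cube_edges: "card (cube_edges d (\<lambda>_. 0) (int n)) \<le> d * (2 * n + 1) ^ d"
proof -
  let ?C = "cube d (\<lambda>_. 0) (int n)"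
  have "cube_edges d (\<lambda>_. 0) (int n) \<subseteq> (\<lambda>(i, x). {x, x(i := x i + 1)}) ` ({..<d} \<times> ?C)"
  proof
    fix e assume "e \<in> cube_edges d (\<lambda>_. 0) (int n)"
    then have e: "e \<in> edges (int_lattice d)" "e \<subseteq> ?C" by (auto simp: cube_edges_def)
    from e(1) obtain x i where "i < d" "e = {x, x(i := x i + 1)}" by (elim edge_int_latticeE)
    with e(2) show "e \<in> (\<lambda>(i, x). {x, x(i := x i + 1)}) ` ({..<d} \<times> ?C)" by auto
  qed
  then have "card (cube_edges d (\<lambda>_. 0) (int n)) \<le> card ({..<d} \<times> ?C)"
    by (rule surj_card_le[rotated]) (simp add: finite_cube)
  then show ?thesis by (simp add: card_cartesian_product card_cube)
qed

text \<open>Every position of an edge inside the cube of radius \<open>n\<close> yields a translate of that cube around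
  one fixed edge, and all these translates fit into the cube of radius \<open>m\<close>. Hence the probability that the
  edge joins two arms in the large cube is at most the density of bridges in the small one.\<close>

lemma cube_arms_edge_le:
  assumes p: "0 < p" "p < 1" and k: "2 \<le> k"
    and x: "x \<in> {..<d} \<rightarrow>\<^sub>E UNIV" and i: "i < d"
    and far: "\<And>j. j < d \<Longrightarrow> \<bar>x j\<bar> + 2 * int (k * k) < m"
  shows "cube_arms p d m x (x(i := x i + 1)) \<le> 13 * real d / (p * real k)"
proof -
  \<comment> \<open>With radius \<open>k * k\<close> and \<open>t = 1 / k\<close> the boundary and
    volume terms of \<open>expect_card_bridges\<close> are both of order
    \<open>n ^ (d - 1) * k\<close>; dividing by the number of positions, of order
    \<open>n ^ d\<close>, leaves 1/k.\<close>
  define n where "n = k * k"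
  define N where "N = 2 * n + 1"
  let ?o = "\<lambda>_::nat. 0::int"
  let ?E = "cube_edges d ?o (int n)"
  let ?B = "rim d ?o (int n)"
  define up where "up z = z(i := z i + 1)" for z :: "nat \<Rightarrow> int"
  \<comment> \<open>The range is half-open in direction \<open>i\<close>, so that
    \<open>up z\<close> stays in the cube as well.\<close>
  define Z where "Z = (\<Pi>\<^sub>E j\<in>{..<d}. if j = i then {- int n..<int n} else {- int n..int n})"
  have Z: "z \<in> cube d ?o (int n)" "up z \<in> cube d ?o (int n)" if "z \<in> Z" for z
  proof -
    have z: "z \<in> {..<d} \<rightarrow>\<^sub>E UNIV" using that by (auto simp: Z_def PiE_iff)
    have "\<bar>z j\<bar> \<le> int n \<and> (j = i \<longrightarrow> z j < int n)" if "j < d" for j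
      using PiE_mem[OF \<open>z \<in> Z\<close>[unfolded Z_def], of j] that by (auto split: if_splits)
    with z i show "z \<in> cube d ?o (int n)" "up z \<in> cube d ?o (int n)"
      by (force simp: in_cube_iff up_def PiE_iff extensional_def)+
  qed
  have finZ: "finite Z" by (auto simp: Z_def intro!: finite_PiE)
  have cardZ: "card Z = 2 * n * N ^ (d - 1)"
    unfolding Z_def N_def using i by (subst card_PiE_one_coordinate) (auto simp: nat_add_distrib nat_mult_distrib)
  have p': "0 \<le> p" "p \<le> 1" using p by auto
  have each: "cube_arms p d m x (up x) \<le> cube_arms p d (int n) z (up z)" if z: "z \<in> Z" for z
  proof -
    \<comment> \<open>Centre of the translate in which \<open>z\<close> takes the place of
      \<open>x\<close>. It is at most \<open>\<bar>x j\<bar> + n\<close> in coordinate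
      \<open>j\<close>, so the translate stays within \<open>\<bar>x j\<bar> + 2 * n\<close>; this
      is the bound in \<open>far\<close>.\<close>
    let ?c = "\<lambda>j. x j - z j"
    have zb: "z \<in> {..<d} \<rightarrow>\<^sub>E UNIV" "\<bar>z j\<bar> \<le> int n" if "j < d" for j
      using Z(1)[OF z] that by (auto simp: in_cube_iff)
    have tr: "translate d ?c z = x" "translate d ?c (up z) = up x"
      using x i by (auto simp: translate_def up_def fun_eq_iff PiE_iff extensional_def)
    have "x \<in> cube d ?c (int n)" "up x \<in> cube d ?c (int n)"
      using Z[OF z] translate_cube[of d ?c "int n"] tr by (metis imageI)+
    moreover have "\<bar>x j - z j\<bar> + int n < m" if "j < d" for j
      using far[OF that] zb[OF that] unfolding n_def by linarith
    ultimately have "cube_arms p d m x (up x)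
        \<le> prb p (cube_edges d ?c (int n)) (\<lambda>S. two_arms (rim d ?c (int n)) S x (up x))"
      by (intro cube_arms_le p')
    also have "\<dots> = cube_arms p d (int n) z (up z)"
      using cube_arms_translate[OF Z[OF z], of p ?c] unfolding tr .
    finally show ?thesis .
  qed
  have bridge: "(\<Sum>z\<in>Z. of_bool (two_arms ?B S z (up z))) \<le> real (card (bridges ?E ?B S))"
    if S: "S \<subseteq> ?E" for S
  proof -
    \<comment> \<open>The unordered edge determines \<open>z\<close> as its lower end, so no bridge
      is counted for two positions.\<close>
    have inj: "inj_on (\<lambda>z. {z, up z}) UNIV"
    proof (rule inj_onI)
      fix z w assume "{z, up z} = {w, up w}"
      then consider "z = w" | "z = up w" "up z = w" by (auto simp: doubleton_eq_iff)
      then show "z = w"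
      proof cases
        case 2
        from fun_cong[OF 2(1), of i] fun_cong[OF 2(2), of i]
        have "z i = w i + 1" "z i + 1 = w i" by (simp_all add: up_def)
        then show ?thesis by simp
      qed
    qed
    have "card {z \<in> Z. two_arms ?B S z (up z)} \<le> card (bridges ?E ?B S)"
    proof (rule card_inj_on_le[OF inj_on_subset[OF inj]])
      show "(\<lambda>z. {z, up z}) ` {z \<in> Z. two_arms ?B S z (up z)} \<subseteq> bridges ?E ?B S"
      proof clarify
        fix z assume z: "z \<in> Z" "two_arms ?B S z (up z)"
        have "{z, up z} \<in> edges (int_lattice d)"
          unfolding up_def using Z(1)[OF z(1)] i by (intro edge_int_latticeI) (auto simp: in_cube_iff)
        with Z[OF z(1)] have "{z, up z} \<in> ?E" by (auto simp: cube_edges_def)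
        with z show "{z, up z} \<in> bridges ?E ?B S" by (auto simp: bridges_def)
      qed
      show "finite (bridges ?E ?B S)" using finite_cube_edges[of d ?o "int n"] by (auto simp: bridges_def)
    qed simp
    moreover have "(\<Sum>z\<in>Z. of_bool (two_arms ?B S z (up z))) = real (card {z \<in> Z. two_arms ?B S z (up z)})"
      using finZ by (simp add: of_bool_def sum.If_cases Int_def)
    ultimately show ?thesis by simp
  qed
  have "real (card Z) * cube_arms p d m x (up x) \<le> (\<Sum>z\<in>Z. cube_arms p d (int n) z (up z))"
    using sum_mono[of Z "\<lambda>_. cube_arms p d m x (up x)", OF each] by simp
  also have "\<dots> = expect p ?E (\<lambda>S. \<Sum>z\<in>Z. of_bool (two_arms ?B S z (up z)))"
    unfolding cube_arms_def by (rule expect_sum[symmetric])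
  also have "\<dots> \<le> expect p ?E (\<lambda>S. card (bridges ?E ?B S))"
    by (intro expect_mono p' bridge)
  also have "\<dots> \<le> (card ?B / (1 / real k) + 4 * (1 / real k) * card ?E) / p"
  proof -
    have "\<exists>x y. e = {x, y}" if "e \<in> ?E" for e
      using that by (auto simp: cube_edges_def int_lattice_def)
    moreover have "finite ?B" using rim_subset finite_cube by (rule finite_subset)
    ultimately have "p * expect p ?E (\<lambda>S. card (bridges ?E ?B S)) \<le> card ?B / (1 / real k) + 4 * (1 / real k) * card ?E"
      using k p by (intro expect_card_bridges finite_cube_edges) auto
    then show ?thesis using p by (simp add: field_simps)
  qed
  also have "\<dots> \<le> (real d * (2 * real N ^ (d - 1)) * k + 4 * (1 / real k) * (real d * real N ^ d)) / p"
  proof -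
    have "real (card ?B) \<le> real (d * (2 * N ^ (d - 1)))"
      using card_rim[of d n] unfolding N_def of_nat_le_iff .
    then have "card ?B / (1 / real k) \<le> real d * (2 * real N ^ (d - 1)) * k"
      by (simp add: mult_right_mono)
    moreover have "real (card ?E) \<le> real (d * N ^ d)"
      using card_cube_edges[of d n] unfolding N_def of_nat_le_iff .
    then have "4 * (1 / real k) * card ?E \<le> 4 * (1 / real k) * (real d * real N ^ d)"
      by (intro mult_left_mono) auto
    ultimately show ?thesis
      using p by (intro divide_right_mono add_mono) auto
  qed
  also have "\<dots> = real N ^ (d - 1) * (real d * (2 * k + 4 * N / k) / p)"
  proof -
    have "real N ^ d = real N * real N ^ (d - 1)" using i by (cases d) auto
    then show ?thesis using k by (simp add: field_simps)
  qed
  finally have "real N ^ (d - 1) * (2 * real n * cube_arms p d m x (up x))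
      \<le> real N ^ (d - 1) * (real d * (2 * k + 4 * N / k) / p)"
    by (simp add: cardZ mult_ac)
  moreover have "0 < real N ^ (d - 1)" by (simp add: N_def)
  ultimately have "2 * real n * cube_arms p d m x (up x) \<le> real d * (2 * k + 4 * N / k) / p"
    by (simp only: mult_le_cancel_left_pos)
  \<comment> \<open>From \<open>N \<le> 3 * k * k\<close> one gets even 14 times \<open>k\<close>;
    the generous 26, halved by the factor \<open>2 * n\<close>, yields the constant 13.\<close>
  also have "\<dots> \<le> real d * (26 * real k) / p"
  proof -
    have "real N \<le> 3 * real k * real k" 
    proof -
      have "1 \<le> k * k" using k by simp
      then have "N \<le> 3 * (k * k)" unfolding N_def n_def by linarith
      then have "real N \<le> real (3 * (k * k))" by (simp only: of_nat_le_iff)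
      then show ?thesis by simp
    qed
    then have "2 * k + 4 * N / k \<le> 26 * real k" using k by (simp add: field_simps)
    then show ?thesis using p by (intro divide_right_mono mult_left_mono) auto
  qed
  finally show ?thesis
    using p k unfolding up_def by (simp add: n_def field_simps)
qed

lemma cube_arms_edge_tendsto:
  assumes p: "0 < p" "p < 1" and x: "x \<in> {..<d} \<rightarrow>\<^sub>E UNIV" and i: "i < d"
  shows "(\<lambda>m. cube_arms p d (int m) x (x(i := x i + 1))) \<longlonglongrightarrow> 0"
proof (rule LIMSEQ_I)
  fix r :: real assume r: "0 < r"
  obtain k :: nat where k: "13 * real d / (p * r) < k" using reals_Archimedean2 by blast
  define K where "K = max k 2"
  have K: "13 * real d / (p * real K) < r" "2 \<le> K"
  proof -
    have "13 * real d / (p * r) < K" using k by (simp add: K_def)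
    then show "13 * real d / (p * real K) < r" using p r by (simp add: K_def field_simps)
  qed (simp add: K_def)
  define M where "M = nat ((\<Sum>j<d. \<bar>x j\<bar>) + 2 * int (K * K)) + 1"
  show "\<exists>no. \<forall>m\<ge>no. norm (cube_arms p d (int m) x (x(i := x i + 1)) - 0) < r"
  proof (intro exI allI impI)
    fix m assume m: "M \<le> m"
    have "\<bar>x j\<bar> + 2 * int (K * K) < int m" if "j < d" for j
    proof -
      have "\<bar>x j\<bar> \<le> (\<Sum>j<d. \<bar>x j\<bar>)" using that by (intro member_le_sum) auto
      with m show ?thesis unfolding M_def by linarith
    qed
    then have "cube_arms p d (int m) x (x(i := x i + 1)) \<le> 13 * real d / (p * real K)"
      by (intro cube_arms_edge_le p K x i)
    moreover have "0 \<le> cube_arms p d (int m) x (x(i := x i + 1))"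
      unfolding cube_arms_def expect_def using p by (intro sum_nonneg mult_nonneg_nonneg prod_nonneg) auto
    ultimately show "norm (cube_arms p d (int m) x (x(i := x i + 1)) - 0) < r" using K by simp
  qed
qed

text \<open>Finite energy iterated. The cost depends only on the number of edges of
  \<open>R\<close>, neither on the event nor on \<open>E\<close>, and so stays bounded as the cubes
  grow.\<close>

lemma prb_union_le:
  assumes "finite E" "R \<subseteq> E" "0 < p" "p < 1"
  shows "prb p E (\<lambda>S. Q (R \<union> S)) \<le> prb p E Q / p ^ card R"
proof -
  have "finite R" using assms finite_subset by blast
  then show ?thesis
    using assms(2)
  proof (induction R arbitrary: Q rule: finite_induct)
    case (insert e R)
    have "prb p E (\<lambda>S. Q (insert e R \<union> S)) = prb p E (\<lambda>S. (\<lambda>T. Q (insert e T)) (R \<union> S))" by simp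
    also have "\<dots> \<le> prb p E (\<lambda>T. Q (insert e T)) / p ^ card R" using insert by (intro insert.IH) auto
    also have "\<dots> \<le> prb p E Q / p / p ^ card R"
      using insert assms by (intro divide_right_mono prb_insert_le) auto
    finally show ?case using insert by (simp add: field_simps)
  qed simp
qed

lemma eventually_in_cube:
  assumes "x \<in> {..<d} \<rightarrow>\<^sub>E UNIV"
  shows "\<forall>\<^sub>F m in sequentially. x \<in> cube d (\<lambda>_. 0) (int m)"
proof (rule eventually_sequentiallyI)
  fix m assume "nat (\<Sum>j<d. \<bar>x j\<bar>) \<le> m"
  moreover have "\<bar>x j\<bar> \<le> (\<Sum>j<d. \<bar>x j\<bar>)" if "j < d" for j using that by (intro member_le_sum) auto
  ultimately show "x \<in> cube d (\<lambda>_. 0) (int m)" using assms by (force simp: in_cube_iff)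
qed

lemma eventually_in_cube_edges:
  assumes "finite R" "R \<subseteq> edges (int_lattice d)"
  shows "\<forall>\<^sub>F m in sequentially. R \<subseteq> cube_edges d (\<lambda>_. 0) (int m)"
proof -
  have "\<forall>\<^sub>F m in sequentially. e \<in> cube_edges d (\<lambda>_. 0) (int m)" if e: "e \<in> edges (int_lattice d)" for e
  proof -
    obtain x y where xy: "e = {x, y}" using e by (elim edge_int_latticeE)
    with e have "x \<in> {..<d} \<rightarrow>\<^sub>E UNIV" "y \<in> {..<d} \<rightarrow>\<^sub>E UNIV" by (auto simp: edges_int_lattice_iff)
    then have "\<forall>\<^sub>F m in sequentially. x \<in> cube d (\<lambda>_. 0) (int m) \<and> y \<in> cube d (\<lambda>_. 0) (int m)"
      by (intro eventually_conj eventually_in_cube)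
    then show ?thesis by eventually_elim (use e xy in \<open>auto simp: cube_edges_def\<close>)
  qed
  then show ?thesis using assms by (auto simp: subset_iff eventually_ball_finite_distrib Ball_def[symmetric])
qed

text \<open>The finite form of uniqueness of the infinite cluster.\<close>

lemma cube_arms_tendsto:
  assumes p: "0 < p" "p < 1" and "linked (edges (int_lattice d)) x y"
    and R: "finite R" "R \<subseteq> edges (int_lattice d)"
  shows "(\<lambda>m. prb p (cube_edges d (\<lambda>_. 0) (int m)) (\<lambda>S. two_arms (rim d (\<lambda>_. 0) (int m)) (R \<union> S) x y)) \<longlonglongrightarrow> 0"
  using assms(3) R
\<comment> \<open>Induction along a lattice path from \<open>x\<close> to \<open>y\<close>, with
  \<open>R\<close> collecting the path edges already forced open: by \<open>two_arms_step\<close>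
  either the current edge has two arms, or it is opened and the event is handed on to the rest of
  the path.\<close>
proof (induction arbitrary: R rule: converse_rtrancl_induct)
  case base
  show ?case by (simp add: two_arms_def finite_cube_edges)
next
  case (step x z)
  let ?E = "\<lambda>m. cube_edges d (\<lambda>_. 0) (int m)"
  let ?A = "\<lambda>m. two_arms (rim d (\<lambda>_. 0) (int m))"
  have e: "{x, z} \<in> edges (int_lattice d)" using step(1) by (simp add: adjacency_def)
  have p': "0 \<le> p" "p \<le> 1" using p by auto
  have nonneg: "0 \<le> prb p E Q" for E :: "(nat \<Rightarrow> int) set set" and Q
    unfolding expect_def using p by (intro sum_nonneg mult_nonneg_nonneg prod_nonneg) auto
  have "(\<lambda>m. cube_arms p d (int m) x z) \<longlonglongrightarrow> 0"
  proof -
    obtain w i where w: "w \<in> {..<d} \<rightarrow>\<^sub>E UNIV" "i < d" "{x, z} = {w, w(i := w i + 1)}"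
      using e by (elim edge_int_latticeE)
    then have "cube_arms p d n x z = cube_arms p d n w (w(i := w i + 1))" for n
      using two_arms_commute[of _ _ "w(i := w i + 1)" w]
      unfolding cube_arms_def by (auto simp: doubleton_eq_iff intro!: expect_cong)
    then show ?thesis using cube_arms_edge_tendsto[OF p w(1,2)] by simp
  qed
  then have lim: "(\<lambda>m. cube_arms p d (int m) x z / p ^ card R
      + prb p (?E m) (\<lambda>S. ?A m (insert {x, z} R \<union> S) z y)) \<longlonglongrightarrow> 0 / p ^ card R + 0"
    using p step(4,5) e by (intro tendsto_add tendsto_divide tendsto_const step.IH) auto
  have "\<forall>\<^sub>F m in sequentially. prb p (?E m) (\<lambda>S. ?A m (R \<union> S) x y)
      \<le> cube_arms p d (int m) x z / p ^ card R + prb p (?E m) (\<lambda>S. ?A m (insert {x, z} R \<union> S) z y)"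
    using eventually_in_cube_edges[OF step(4,5)]
  proof eventually_elim
    case (elim m)
    have "prb p (?E m) (\<lambda>S. ?A m (R \<union> S) x y) \<le> prb p (?E m) (\<lambda>S. ?A m (R \<union> S) x z)
        + prb p (?E m) (\<lambda>S. ?A m (insert {x, z} R \<union> S) z y)"
    proof (intro prb_union p')
      fix S assume "?A m (R \<union> S) x y"
      from two_arms_step[OF this refl, of z]
      show "?A m (R \<union> S) x z \<or> ?A m (insert {x, z} R \<union> S) z y" by simp
    qed
    also have "prb p (?E m) (\<lambda>S. ?A m (R \<union> S) x z) \<le> cube_arms p d (int m) x z / p ^ card R"
      unfolding cube_arms_def by (intro prb_union_le finite_cube_edges elim p)
    finally show ?case by simp
  qed
  then show ?case
    using nonneg by (intro tendsto_sandwich[OF _ _ tendsto_const lim[simplified]]) auto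
qed

lemma linked_int_lattice:
  assumes xy: "x \<in> {..<d} \<rightarrow>\<^sub>E UNIV" "y \<in> {..<d} \<rightarrow>\<^sub>E UNIV"
  shows "linked (edges (int_lattice d)) x y"
proof -
  let ?L = "linked (edges (int_lattice d))"
  have up: "?L w (w(i := w i + int n))" if "w \<in> {..<d} \<rightarrow>\<^sub>E UNIV" "i < d" for w i n
  proof (induction n)
    case (Suc n)
    let ?v = "w(i := w i + int n)"
    have "?v \<in> {..<d} \<rightarrow>\<^sub>E UNIV" using that by (auto simp: PiE_iff extensional_def)
    from linked_edge[OF edge_int_latticeI[OF this that(2)]]
    have "?L ?v (w(i := w i + int (Suc n)))" by (simp add: add_ac)
    with Suc show ?case by (rule rtrancl_trans)
  qed simp
  have line: "?L w (w(i := a))" if w: "w \<in> {..<d} \<rightarrow>\<^sub>E UNIV" "i < d" for w i a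
  proof (cases "w i \<le> a")
    case True
    with up[OF w, of "nat (a - w i)"] show ?thesis by simp
  next
    case False
    have "w(i := a) \<in> {..<d} \<rightarrow>\<^sub>E UNIV" using w by (auto simp: PiE_iff extensional_def)
    from up[OF this w(2), of "nat (w i - a)"] False have "?L (w(i := a)) w" by simp
    then show ?thesis by (rule linked_sym)
  qed
  have "?L x (\<lambda>i. if i < k then y i else x i)" if "k \<le> d" for k
    using that
  proof (induction k)
    case (Suc k)
    let ?v = "\<lambda>i. if i < k then y i else x i"
    have "?v \<in> {..<d} \<rightarrow>\<^sub>E UNIV" using xy by (auto simp: PiE_iff extensional_def)
    then have last: "?L ?v (?v(k := y k))" using Suc.prems by (intro line) auto
    have eq: "?v(k := y k) = (\<lambda>i. if i < Suc k then y i else x i)" by (auto simp: fun_eq_iff)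
    have "?L x ?v" using Suc by simp
    from rtrancl_trans[OF this last] show ?case unfolding eq .
  qed simp
  from this[of d] have "?L x (\<lambda>i. if i < d then y i else x i)" by simp
  moreover have "(\<lambda>i. if i < d then y i else x i) = y"
    using xy by (auto simp: fun_eq_iff PiE_iff extensional_def)
  ultimately show ?thesis by simp
qed

lemma int_lattice_limit:
  assumes "0 \<le> p" "p \<le> 1"
  shows "(\<lambda>m. prb p (cube_edges d (\<lambda>_. 0) (int m)) (\<lambda>S. linked S x y))
    \<longlonglongrightarrow> connection_prob p (int_lattice d) x y"
proof (rule connection_prob_limit[OF assms])
  show "incseq (\<lambda>m. cube_edges d (\<lambda>_. 0) (int m))"
    by (fastforce simp: incseq_def cube_edges_def in_cube_iff)
  show "(\<Union>m. cube_edges d (\<lambda>_. 0) (int m)) = edges (int_lattice d)"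
  proof (intro equalityI subsetI)
    fix e assume "e \<in> edges (int_lattice d)"
    then have "\<forall>\<^sub>F m in sequentially. {e} \<subseteq> cube_edges d (\<lambda>_. 0) (int m)"
      by (intro eventually_in_cube_edges) auto
    then show "e \<in> (\<Union>m. cube_edges d (\<lambda>_. 0) (int m))"
      by (auto dest!: eventually_happens)
  qed (auto simp: cube_edges_def)
qed (rule finite_cube_edges)

section \<open>Comparison with layered graphs\<close>

lemma edges_layered_iff:
  "{(w, l), (w', l')} \<in> edges (layered_graph G) \<longleftrightarrow>
     l = l' \<and> {w, w'} \<in> edges G \<or> w = w' \<and> w \<in> verts G \<and> \<bar>l - l'\<bar> = 1"
  (is "?L \<longleftrightarrow> ?R")
proof
  assume ?L
  then show ?R
    by (auto simp: layered_graph_def doubleton_eq_iff insert_commute)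
next
  assume ?R
  then consider "l = l'" "{w, w'} \<in> edges G" | "w = w'" "w \<in> verts G" "l = l' - 1" | "w = w'" "w \<in> verts G" "l' = l - 1"
    by linarith
  then show ?L
    by cases (auto simp: layered_graph_def insert_commute)
qed

lemma edges_cartesian_power_iff:
  "{x, y} \<in> edges (cartesian_power G m) \<longleftrightarrow> x \<in> {..<m} \<rightarrow>\<^sub>E verts G \<and> y \<in> {..<m} \<rightarrow>\<^sub>E verts G \<and>
     (\<exists>i<m. {x i, y i} \<in> edges G \<and> (\<forall>j<m. j \<noteq> i \<longrightarrow> x j = y j))"
  unfolding cartesian_power_def sgraph.sel
  by (auto simp: doubleton_eq_iff insert_commute)

lemma verts_cartesian_power [simp]: "verts (cartesian_power G m) = {..<m} \<rightarrow>\<^sub>E verts G"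
  by (simp add: cartesian_power_def)

lemma countable_edges_layered:
  assumes "countable (verts G)" "\<And>e. e \<in> edges G \<Longrightarrow> \<exists>x\<in>verts G. \<exists>y\<in>verts G. e = {x, y}"
  shows "countable (edges (layered_graph G))"
proof -
  let ?V = "verts G \<times> (UNIV :: int set)"
  have "edges (layered_graph G) \<subseteq> (\<lambda>(a, b). {a, b}) ` (?V \<times> ?V)"
  proof
    fix e assume "e \<in> edges (layered_graph G)"
    then consider u v l where "e = {(u, l), (v, l)}" "{u, v} \<in> edges G"
      | u l where "e = {(u, l - 1), (u, l)}" "u \<in> verts G"
      by (auto simp: layered_graph_def)
    then show "e \<in> (\<lambda>(a, b). {a, b}) ` (?V \<times> ?V)"
    proof cases
      case 1
      then have "u \<in> verts G" "v \<in> verts G" using assms(2)[OF 1(2)] by (auto simp: doubleton_eq_iff)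
      with 1 show ?thesis by (auto intro!: image_eqI[of _ _ "((u, l), (v, l))"])
    next
      case 2
      then show ?thesis by (auto intro!: image_eqI[of _ _ "((u, l - 1), (u, l))"])
    qed
  qed
  then show ?thesis
    by (rule countable_subset) (intro countable_image countable_SIGMA assms(1) countableI_type)
qed

text \<open>On \<open>{..2 * m}\<close> the graph looks like a path whose inner vertices have no further neighbours, so
  that cycles and linear graphs can be treated alike.\<close>

definition locally_path :: "nat \<Rightarrow> nat sgraph \<Rightarrow> bool" where
  "locally_path m K \<longleftrightarrow> finite (verts K) \<and> {..2 * m} \<subseteq> verts K \<and>
     (\<forall>i\<le>2 * m. \<forall>j\<le>2 * m. {i, j} \<in> edges K \<longleftrightarrow> i = Suc j \<or> j = Suc i) \<and>
     (\<forall>i j. 0 < i \<and> i < 2 * m \<and> {i, j} \<in> edges K \<longrightarrow> j \<le> 2 * m)"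

lemma locally_path_linear: "locally_path m (linear_graph (2 * m + 2))"
  by (auto simp: locally_path_def linear_graph_def doubleton_eq_iff)

text \<open>On \<open>2 * m + 1\<close> vertices the closing edge of the cycle would join 0 to
  \<open>2 * m\<close>. The extra vertex \<open>2 * m + 1\<close> takes over that edge, so that
  \<open>{..2 * m}\<close> spans a path.\<close>

lemma locally_path_cycle: "locally_path m (cycle_graph (2 * m + 2))"
proof -
  have succ: "Suc a mod (2 * m + 2) = (if a = 2 * m + 1 then 0 else Suc a)" if "a < 2 * m + 2" for a
    using that by auto
  have edge: "{i, j} \<in> edges (cycle_graph (2 * m + 2)) \<longleftrightarrow> i = 2 * m + 1 \<and> j = 0 \<or> j = 2 * m + 1 \<and> i = 0
      \<or> i < 2 * m + 1 \<and> j = Suc i \<or> j < 2 * m + 1 \<and> i = Suc j" for i j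
  proof -
    have "{i, j} \<in> edges (cycle_graph (2 * m + 2)) \<longleftrightarrow> (\<exists>a<2 * m + 2. {i, j} = {a, Suc a mod (2 * m + 2)})"
      unfolding cycle_graph_def sgraph.sel by auto
    also have "\<dots> \<longleftrightarrow> (\<exists>a<2 * m + 2. {i, j} = {a, if a = 2 * m + 1 then 0 else Suc a})"
      by (intro ex_cong1 conj_cong refl) (simp only: succ)
    also have "\<dots> \<longleftrightarrow> {i, j} = {2 * m + 1, 0} \<or> (\<exists>a<2 * m + 1. {i, j} = {a, Suc a})"
    proof
      assume "\<exists>a<2 * m + 2. {i, j} = {a, if a = 2 * m + 1 then 0 else Suc a}"
      then obtain a where a: "a < 2 * m + 2" "{i, j} = {a, if a = 2 * m + 1 then 0 else Suc a}" by blast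
      then show "{i, j} = {2 * m + 1, 0} \<or> (\<exists>a<2 * m + 1. {i, j} = {a, Suc a})"
      proof (cases "a = 2 * m + 1")
        case False
        with a have "a < 2 * m + 1" "{i, j} = {a, Suc a}" by simp_all
        then show ?thesis by blast
      qed simp
    next
      assume "{i, j} = {2 * m + 1, 0} \<or> (\<exists>a<2 * m + 1. {i, j} = {a, Suc a})"
      then show "\<exists>a<2 * m + 2. {i, j} = {a, if a = 2 * m + 1 then 0 else Suc a}"
      proof
        assume "\<exists>a<2 * m + 1. {i, j} = {a, Suc a}"
        then obtain a where "a < 2 * m + 1" "{i, j} = {a, Suc a}" by blast
        then show ?thesis by (intro exI[of _ a]) simp
      qed (intro exI[of _ "2 * m + 1"], simp)
    qed
    finally show ?thesis unfolding doubleton_eq_iff by blast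
  qed
  have "finite (verts (cycle_graph (2 * m + 2)))" "{..2 * m} \<subseteq> verts (cycle_graph (2 * m + 2))"
    by (auto simp: cycle_graph_def)
  then show ?thesis
    unfolding locally_path_def edge by (intro conjI allI impI) (assumption | linarith)+
qed

section \<open>Cubes as boxes in layered graphs, one coordinate becoming the height\<close>

definition skip :: "nat \<Rightarrow> nat \<Rightarrow> nat" where
  "skip i j = (if j < i then j else Suc j)"

lemma skip_inj [simp]: "skip i j = skip i k \<longleftrightarrow> j = k"
  by (auto simp: skip_def)

lemma skip_neq [simp]: "skip i j \<noteq> i" "i \<noteq> skip i j"
  by (auto simp: skip_def)

lemma skip_less: "i < d \<Longrightarrow> j < d - 1 \<Longrightarrow> skip i j < d"
  by (auto simp: skip_def)

lemma less_cases_skip: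
  assumes "k < d" "i < d"
  obtains "k = i" | j where "j < d - 1" "k = skip i j"
proof (cases "k = i")
  case False
  then have "k = skip i (if k < i then k else k - 1)" "(if k < i then k else k - 1) < d - 1"
    using assms by (auto simp: skip_def)
  then show ?thesis using that by blast
qed (use that in auto)

lemma all_less_skip_iff:
  "i < d \<Longrightarrow> (\<forall>k<d. P k) \<longleftrightarrow> P i \<and> (\<forall>j<d - 1. P (skip i j))"
  by (metis less_cases_skip skip_less)

lemma ex_less_skip_iff:
  "i < d \<Longrightarrow> (\<exists>k<d. P k) \<longleftrightarrow> P i \<or> (\<exists>j<d - 1. P (skip i j))"
  by (metis less_cases_skip skip_less)

text \<open>Coordinate \<open>i\<close> becomes the height relative to \<open>c\<close>. The others,
  renumbered by \<open>skip\<close> (the increasing enumeration of all indices except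
  \<open>i\<close>), are shifted by \<open>m\<close> into the range from 0 to \<open>2 * m\<close>;
  on the cube of radius \<open>m\<close> the shifted values are nonnegative, so \<open>nat\<close>
  loses nothing.\<close>

definition cylinder_embedding :: "nat \<Rightarrow> nat \<Rightarrow> int \<Rightarrow> nat \<Rightarrow> (nat \<Rightarrow> int) \<Rightarrow> (nat \<Rightarrow> nat) \<times> int" where
  "cylinder_embedding d i c m x = (\<lambda>j\<in>{..<d - 1}. nat (x (skip i j) + int m), x i - c)"

context
  fixes d i m :: nat and c :: int and K :: "nat sgraph"
  assumes i: "i < d" and K: "locally_path m K"
begin

private abbreviation "f \<equiv> cylinder_embedding d i c m"
private abbreviation "C \<equiv> cube d (\<lambda>_. 0) (int m)"
private abbreviation "H \<equiv> layered_graph (cartesian_power K (d - 1))"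

lemma cylinder_embedding_image:
  "f ` C = {(w, l). w \<in> {..<d - 1} \<rightarrow>\<^sub>E {..2 * m} \<and> \<bar>l + c\<bar> \<le> int m}"
proof (intro equalityI subsetI)
  fix z assume "z \<in> f ` C"
  then obtain x where x: "z = f x" "x \<in> C" by auto
  have "x (skip i j) \<le> int m" if "j < d - 1" for j
    using x(2) skip_less[OF i that] by (fastforce simp: in_cube_iff abs_le_iff)
  with x i show "z \<in> {(w, l). w \<in> {..<d - 1} \<rightarrow>\<^sub>E {..2 * m} \<and> \<bar>l + c\<bar> \<le> int m}"
    by (force simp: cylinder_embedding_def in_cube_iff)
next
  fix z assume "z \<in> {(w, l). w \<in> {..<d - 1} \<rightarrow>\<^sub>E {..2 * m} \<and> \<bar>l + c\<bar> \<le> int m}"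
  then obtain w l where z: "z = (w, l)" "w \<in> {..<d - 1} \<rightarrow>\<^sub>E {..2 * m}" "\<bar>l + c\<bar> \<le> int m" by auto
  \<comment> \<open>The inverse of the embedding; \<open>if k < i then k else k - 1\<close> undoes
    \<open>skip\<close>.\<close>
  define x where "x = (\<lambda>k\<in>{..<d}. if k = i then l + c else int (w (if k < i then k else k - 1)) - int m)"
  have xs: "x (skip i j) = int (w j) - int m" if "j < d - 1" for j
    using i that by (auto simp: x_def skip_def)
  have xi: "x i = l + c" using i by (simp add: x_def)
  have "\<bar>x (skip i j)\<bar> \<le> int m" if "j < d - 1" for j
  proof -
    have "w j \<le> 2 * m" using PiE_mem[OF z(2), of j] that by simp
    then show ?thesis unfolding xs[OF that] by linarith
  qed
  moreover have "x \<in> {..<d} \<rightarrow>\<^sub>E UNIV" by (simp add: x_def)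
  ultimately have "x \<in> C"
    unfolding in_cube_iff diff_zero all_less_skip_iff[OF i] using z(3) xi by simp
  moreover have "f x = z"
  proof -
    have "(\<lambda>j\<in>{..<d - 1}. nat (x (skip i j) + int m)) = w"
    proof
      fix j
      show "(\<lambda>j\<in>{..<d - 1}. nat (x (skip i j) + int m)) j = w j"
        using PiE_arb[OF z(2), of j] by (cases "j < d - 1") (simp_all add: xs)
    qed
    then show ?thesis by (simp add: cylinder_embedding_def z(1) xi)
  qed
  ultimately show "z \<in> f ` C" by blast
qed

lemma cube_coord:
  assumes "x \<in> C"
  shows "\<bar>x i\<bar> \<le> int m" "j < d - 1 \<Longrightarrow> \<bar>x (skip i j)\<bar> \<le> int m"
proof -
  have C: "\<bar>x k\<bar> \<le> int m" if "k < d" for k using assms that by (simp add: in_cube_iff)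
  show "\<bar>x i\<bar> \<le> int m" using i by (rule C)
  show "\<bar>x (skip i j)\<bar> \<le> int m" if "j < d - 1" using skip_less[OF i that] by (rule C)
qed

lemma cube_ext:
  assumes "x \<in> C" "y \<in> C"
  shows "x = y \<longleftrightarrow> x i = y i \<and> (\<forall>j<d - 1. x (skip i j) = y (skip i j))"
proof -
  have "x = y \<longleftrightarrow> (\<forall>k<d. x k = y k)"
  proof
    assume "\<forall>k<d. x k = y k"
    then show "x = y"
      using assms by (intro PiE_ext[of x "{..<d}" "\<lambda>_. UNIV" y]) (simp_all add: in_cube_iff)
  qed simp
  then show ?thesis using all_less_skip_iff[OF i, of "\<lambda>k. x k = y k"] by simp
qed

lemma nat_shift_eq:
  assumes "\<bar>a\<bar> \<le> int m" "\<bar>b\<bar> \<le> int m"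
  shows "nat (a + int m) = nat (b + int m) \<longleftrightarrow> a = b"
  using assms by (auto simp: eq_nat_nat_iff abs_le_iff)

lemma nat_shift_edge:
  assumes "\<bar>a\<bar> \<le> int m" "\<bar>b\<bar> \<le> int m"
  shows "{nat (a + int m), nat (b + int m)} \<in> edges K \<longleftrightarrow> \<bar>a - b\<bar> = 1"
proof -
  have "nat (a + int m) \<le> 2 * m" "nat (b + int m) \<le> 2 * m" using assms by (auto simp: abs_le_iff)
  then have "{nat (a + int m), nat (b + int m)} \<in> edges K
      \<longleftrightarrow> nat (a + int m) = Suc (nat (b + int m)) \<or> nat (b + int m) = Suc (nat (a + int m))"
    using K unfolding locally_path_def by blast
  also have "\<dots> \<longleftrightarrow> \<bar>a - b\<bar> = 1" using assms by linarith
  finally show ?thesis .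
qed

lemma fst_embedding_eq_iff:
  assumes "x \<in> C" "y \<in> C"
  shows "fst (f x) = fst (f y) \<longleftrightarrow> (\<forall>j<d - 1. x (skip i j) = y (skip i j))"
  using cube_coord(2)[OF assms(1)] cube_coord(2)[OF assms(2)]
  by (auto simp: cylinder_embedding_def fun_eq_iff nat_shift_eq restrict_def)

lemma inj_on_cylinder_embedding: "inj_on f C"
proof (rule inj_onI)
  fix x y assume xy: "x \<in> C" "y \<in> C" "f x = f y"
  then have "fst (f x) = fst (f y)" "snd (f x) = snd (f y)" by auto
  with xy(1,2) show "x = y"
    by (simp add: cube_ext fst_embedding_eq_iff) (simp add: cylinder_embedding_def)
qed

lemma fst_embedding_range: "x \<in> C \<Longrightarrow> fst (f x) \<in> {..<d - 1} \<rightarrow>\<^sub>E {..2 * m}"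
  using imageI[of x C f] unfolding cylinder_embedding_image by (simp add: case_prod_unfold)

lemma fst_embedding_in_verts: "x \<in> C \<Longrightarrow> fst (f x) \<in> {..<d - 1} \<rightarrow>\<^sub>E verts K"
proof -
  assume "x \<in> C"
  moreover have "{..2 * m} \<subseteq> verts K" using K unfolding locally_path_def by blast
  ultimately show ?thesis
    using fst_embedding_range PiE_mono[of "{..<d - 1}" "\<lambda>_. {..2 * m}" "\<lambda>_. verts K"] by blast
qed

lemma cylinder_embedding_edge_iff:
  assumes x: "x \<in> C" and y: "y \<in> C"
  shows "{f x, f y} \<in> edges H \<longleftrightarrow> {x, y} \<in> edges (int_lattice d)"
proof -
  have fx: "f z = (fst (f z), z i - c)" for z by (simp add: cylinder_embedding_def)
  have coord: "fst (f z) j = nat (z (skip i j) + int m)" if "j < d - 1" for z j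
    using that by (simp add: cylinder_embedding_def)
  have "{f x, f y} \<in> edges H \<longleftrightarrow>
      x i = y i \<and> (\<exists>j<d - 1. {fst (f x) j, fst (f y) j} \<in> edges K \<and> (\<forall>k<d - 1. k \<noteq> j \<longrightarrow> fst (f x) k = fst (f y) k))
      \<or> fst (f x) = fst (f y) \<and> \<bar>x i - y i\<bar> = 1"
    using fst_embedding_in_verts[OF x] fst_embedding_in_verts[OF y]
    by (subst fx, subst (2) fx) (simp add: edges_layered_iff edges_cartesian_power_iff)
  also have "\<dots> \<longleftrightarrow> x i = y i \<and> (\<exists>j<d - 1. \<bar>x (skip i j) - y (skip i j)\<bar> = 1
        \<and> (\<forall>k<d - 1. k \<noteq> j \<longrightarrow> x (skip i k) = y (skip i k)))
      \<or> (\<forall>k<d - 1. x (skip i k) = y (skip i k)) \<and> \<bar>x i - y i\<bar> = 1"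
    using cube_coord(2)[OF x] cube_coord(2)[OF y]
    by (simp add: fst_embedding_eq_iff[OF x y] coord nat_shift_edge nat_shift_eq cong: conj_cong)
  also have "\<dots> \<longleftrightarrow> (\<exists>k<d. \<bar>x k - y k\<bar> = 1 \<and> (\<forall>j<d. j \<noteq> k \<longrightarrow> x j = y j))"
    unfolding ex_less_skip_iff[OF i] all_less_skip_iff[OF i] by auto
  also have "\<dots> \<longleftrightarrow> {x, y} \<in> edges (int_lattice d)"
    using x y by (simp add: edges_int_lattice_iff in_cube_iff)
  finally show ?thesis .
qed

lemma cylinder_embedding_edges:
  "(`) f ` cube_edges d (\<lambda>_. 0) (int m) = {e \<in> edges H. e \<subseteq> f ` C}"
proof (intro equalityI subsetI)
  fix e assume "e \<in> (`) f ` cube_edges d (\<lambda>_. 0) (int m)"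
  then obtain a where a: "a \<in> edges (int_lattice d)" "a \<subseteq> C" "e = f ` a" by (auto simp: cube_edges_def)
  from a(1) obtain x y where "a = {x, y}" by (elim edge_int_latticeE)
  with a have "x \<in> C" "y \<in> C" "{x, y} \<in> edges (int_lattice d)" "e = {f x, f y}" by auto
  then show "e \<in> {e \<in> edges H. e \<subseteq> f ` C}" using cylinder_embedding_edge_iff by blast
next
  fix e assume "e \<in> {e \<in> edges H. e \<subseteq> f ` C}"
  then have e: "e \<in> edges H" "e \<subseteq> f ` C" by auto
  from e(1) obtain a b where "e = {a, b}" by (auto simp: layered_graph_def)
  with e obtain x y where xy: "x \<in> C" "y \<in> C" "e = {f x, f y}" by auto
  with e(1) have "{x, y} \<in> edges (int_lattice d)" using cylinder_embedding_edge_iff by blast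
  with xy have "{x, y} \<in> cube_edges d (\<lambda>_. 0) (int m)" by (simp add: cube_edges_def)
  then show "e \<in> (`) f ` cube_edges d (\<lambda>_. 0) (int m)" using xy by (auto intro!: image_eqI[of _ _ "{x, y}"])
qed

text \<open>Away from the rim the base coordinates lie strictly between 0 and \<open>2 * m\<close>,
  where \<open>locally_path\<close> allows no neighbours beyond \<open>2 * m\<close>, and the height
  can still change by one. The closing edges of cycles, the extra vertices and the layers beyond the
  box are visible from the rim only.\<close>

lemma cylinder_embedding_interior:
  assumes x: "x \<in> C - rim d (\<lambda>_. 0) (int m)" and e: "{f x, z} \<in> edges H"
  shows "z \<in> f ` C"
proof -
  obtain w l where z: "z = (w, l)" by fastforce
  have inner: "\<bar>x k\<bar> < int m" if "k < d" for k
    using x that by (force simp: rim_def in_cube_iff)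
  have fx: "fst (f x) \<in> {..<d - 1} \<rightarrow>\<^sub>E {..2 * m}"
    using x by (intro fst_embedding_range) simp
  have "{(fst (f x), x i - c), (w, l)} \<in> edges H"
    using e by (simp add: z cylinder_embedding_def)
  then consider "l = x i - c" "{fst (f x), w} \<in> edges (cartesian_power K (d - 1))"
    | "w = fst (f x)" "\<bar>x i - c - l\<bar> = 1"
    unfolding edges_layered_iff by auto
  then show ?thesis
  proof cases
    case 1
    then obtain j where w: "w \<in> {..<d - 1} \<rightarrow>\<^sub>E verts K" and j: "j < d - 1" "{fst (f x) j, w j} \<in> edges K"
      and others: "\<forall>k<d - 1. k \<noteq> j \<longrightarrow> fst (f x) k = w k"
      unfolding edges_cartesian_power_iff by auto
    have "0 < fst (f x) j" "fst (f x) j < 2 * m"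
      using inner[OF skip_less[OF i j(1)]] j(1) by (auto simp: cylinder_embedding_def abs_less_iff)
    with j(2) K have "w j \<le> 2 * m" unfolding locally_path_def by blast
    moreover have "w k \<le> 2 * m" if "k < d - 1" "k \<noteq> j" for k
      using others that fx by (metis PiE_mem atMost_iff lessThan_iff)
    ultimately have "w \<in> {..<d - 1} \<rightarrow>\<^sub>E {..2 * m}"
      using w by (auto simp: PiE_iff)
    then show ?thesis
      unfolding cylinder_embedding_image using z 1 inner[OF i] by auto
  next
    case 2
    then show ?thesis
      unfolding cylinder_embedding_image using z fx inner[OF i] by auto
  qed
qed

lemma cylinder_connection_bounds:
  assumes p: "0 \<le> p" "p \<le> 1" and xy: "x \<in> C" "y \<in> C"
  shows "prb p (cube_edges d (\<lambda>_. 0) (int m)) (\<lambda>S. linked S x y) \<le> connection_prob p H (f x) (f y)"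
    and "connection_prob p H (f x) (f y) \<le> prb p (cube_edges d (\<lambda>_. 0) (int m)) (\<lambda>S. linked S x y)
      + cube_arms p d (int m) x y"
proof -
  have "countable (edges H)"
  proof (rule countable_edges_layered)
    have "finite (verts (cartesian_power K (d - 1)))"
      using K by (auto simp: locally_path_def intro!: finite_PiE)
    then show "countable (verts (cartesian_power K (d - 1)))" by (rule countable_finite)
  qed (auto simp: cartesian_power_def)
  note bounds = connection_prob_box[OF p this finite_cube_edges Union_cube_edges
      inj_on_cylinder_embedding rim_subset xy cylinder_embedding_edges cylinder_embedding_interior]
  show "prb p (cube_edges d (\<lambda>_. 0) (int m)) (\<lambda>S. linked S x y) \<le> connection_prob p H (f x) (f y)"
    by (rule bounds(1))
  show "connection_prob p H (f x) (f y) \<le> prb p (cube_edges d (\<lambda>_. 0) (int m)) (\<lambda>S. linked S x y)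
      + cube_arms p d (int m) x y"
    unfolding cube_arms_def by (rule bounds(2))
qed

end

text \<open>The two targets differ only in coordinate \<open>i\<close>, so they lie above the same
  base vertex and the layered property compares their heights. The farther one is bounded from below
  by its connection inside the cube; only the nearer one needs the two-arm error, which vanishes in
  the limit.\<close>

lemma int_lattice_monotone_coordinate:
  assumes p: "0 < p" "p < 1" and i: "i < d"
    and xy: "x \<in> {..<d} \<rightarrow>\<^sub>E UNIV" "y \<in> {..<d} \<rightarrow>\<^sub>E UNIV" and le: "x i \<le> y i" "y i \<le> a"
    and K: "\<And>m. locally_path m (K m)" "\<And>m. layered_property p (cartesian_power (K m) (d - 1))"
  shows "connection_prob p (int_lattice d) x (y(i := a)) \<le> connection_prob p (int_lattice d) x y"
proof -
  have p': "0 \<le> p" "p \<le> 1" using p by auto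
  let ?z = "y(i := a)"
  let ?Q = "\<lambda>m v. prb p (cube_edges d (\<lambda>_. 0) (int m)) (\<lambda>S. linked S x v)"
  have z: "?z \<in> {..<d} \<rightarrow>\<^sub>E UNIV" using xy i by (auto simp: PiE_iff extensional_def)
  have "(\<lambda>m. cube_arms p d (int m) x y) \<longlonglongrightarrow> 0"
    using cube_arms_tendsto[OF p linked_int_lattice[OF xy], of "{}"] by (simp add: cube_arms_def)
  then have "(\<lambda>m. ?Q m y + cube_arms p d (int m) x y) \<longlonglongrightarrow> connection_prob p (int_lattice d) x y + 0"
    by (intro tendsto_add int_lattice_limit p')
  then have lim: "(\<lambda>m. ?Q m y + cube_arms p d (int m) x y) \<longlonglongrightarrow> connection_prob p (int_lattice d) x y"
    by simp
  have "\<forall>\<^sub>F m in sequentially. ?Q m ?z \<le> ?Q m y + cube_arms p d (int m) x y"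
    using eventually_in_cube[OF xy(1)] eventually_in_cube[OF xy(2)] eventually_in_cube[OF z]
  proof eventually_elim
    case (elim m)
    let ?H = "layered_graph (cartesian_power (K m) (d - 1))"
    \<comment> \<open>Heights are measured from the starting point, because the layered property
      starts in layer 0.\<close>
    let ?f = "cylinder_embedding d i (x i) m"
    have fx: "?f x = (fst (?f x), 0)" and fy: "?f y = (fst (?f y), y i - x i)"
      and fz: "?f ?z = (fst (?f y), a - x i)"
      by (simp_all add: cylinder_embedding_def)
    have "?Q m ?z \<le> connection_prob p ?H (?f x) (?f ?z)"
      by (rule cylinder_connection_bounds(1)[OF i K(1) p' elim(1,3)])
    also have "\<dots> \<le> connection_prob p ?H (?f x) (?f y)"
    proof -
      have "fst (?f x) \<in> verts (cartesian_power (K m) (d - 1))" "fst (?f y) \<in> verts (cartesian_power (K m) (d - 1))"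
        using fst_embedding_in_verts[OF i K(1) elim(1)] fst_embedding_in_verts[OF i K(1) elim(2)] by simp_all
      moreover have "0 \<le> y i - x i" "y i - x i \<le> a - x i" using le by auto
      ultimately show ?thesis
        using K(2)[of m] unfolding layered_property_def by (subst fx, subst (2) fx, subst fy, subst fz) blast
    qed
    also have "\<dots> \<le> ?Q m y + cube_arms p d (int m) x y"
      by (rule cylinder_connection_bounds(2)[OF i K(1) p' elim(1,2)])
    finally show ?case .
  qed
  then show ?thesis
    by (intro tendsto_le[OF _ lim int_lattice_limit[OF p']]) auto
qed

lemma lattice_monotone_if_layered:
  assumes p: "0 < p" "p < 1"
    and K: "\<And>m. locally_path m (K m)" "\<And>m. layered_property p (cartesian_power (K m) (d - 1))"
  shows "lattice_monotone p d"
  unfolding lattice_monotone_def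
proof (intro ballI impI)
  fix w u v
  assume "w \<in> verts (int_lattice d)" "u \<in> verts (int_lattice d)" "v \<in> verts (int_lattice d)"
    and le: "lattice_le d w u \<and> lattice_le d u v"
  then have V: "w \<in> {..<d} \<rightarrow>\<^sub>E UNIV" "u \<in> {..<d} \<rightarrow>\<^sub>E UNIV" "v \<in> {..<d} \<rightarrow>\<^sub>E UNIV" by simp_all
  let ?P = "connection_prob p (int_lattice d) w"
  \<comment> \<open>The coordinates of \<open>u\<close> are raised to those of \<open>v\<close> one
    at a time; each comparison uses the order in that coordinate alone.\<close>
  have "?P (\<lambda>j. if j < k then v j else u j) \<le> ?P u" if "k \<le> d" for k
    using that
  proof (induction k)
    case (Suc k)
    let ?y = "\<lambda>j. if j < k then v j else u j"
    have "?y \<in> {..<d} \<rightarrow>\<^sub>E UNIV" using V by (auto simp: PiE_iff extensional_def)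
    then have "?P (?y(k := v k)) \<le> ?P ?y"
      using le Suc.prems V by (intro int_lattice_monotone_coordinate[OF p _ _ _ _ _ K]) (auto simp: lattice_le_def)
    moreover have "?y(k := v k) = (\<lambda>j. if j < Suc k then v j else u j)" by (auto simp: fun_eq_iff)
    ultimately show ?case using Suc by simp
  qed simp
  from this[of d] have "?P (\<lambda>j. if j < d then v j else u j) \<le> ?P u" by simp
  moreover have "(\<lambda>j. if j < d then v j else u j) = v"
    using V by (auto simp: fun_eq_iff PiE_iff extensional_def)
  ultimately show "?P v \<le> ?P u" by simp
qed

section \<open>Reflection of bunkbed graphs\<close>

lemma connection_prob_relabel:
  assumes p: "0 \<le> p" "p \<le> 1" and H: "finite (edges H)" "\<Union>(edges H) \<subseteq> V"
    and f: "inj_on f V" and uv: "u \<in> V" "v \<in> V" and H': "edges H' = (`) f ` edges H"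
  shows "connection_prob p H' (f u) (f v) = connection_prob p H u v"
proof -
  have inj: "inj_on ((`) f) (edges H)"
    using inj_on_image_Pow[OF f] H(2) by (auto intro: inj_on_subset)
  have "finite (edges H')" using H H' by simp
  then have "connection_prob p H' (f u) (f v) = prb p ((`) f ` edges H) (\<lambda>S. linked S (f u) (f v))"
    using connection_prob_finite[OF p, of H'] H' by simp
  also have "\<dots> = prb p (edges H) (\<lambda>S. linked ((`) f ` S) (f u) (f v))"
    by (rule expect_image[OF inj])
  also have "\<dots> = prb p (edges H) (\<lambda>S. linked S u v)"
  proof (rule expect_cong)
    fix S assume "S \<subseteq> edges H"
    then have "\<Union>S \<subseteq> V" using H(2) by blast
    then show "of_bool (linked ((`) f ` S) (f u) (f v)) = (of_bool (linked S u v) :: real)"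
      using linked_image[OF f _ uv] by simp
  qed
  also have "\<dots> = connection_prob p H u v"
    by (rule connection_prob_finite[OF p H(1), symmetric])
  finally show ?thesis .
qed

lemma edge_in_simple_graph:
  assumes "simple_graph G" "{u, v} \<in> edges G"
  shows "u \<in> verts G" "v \<in> verts G" "u \<noteq> v"
  using assms by (force simp: simple_graph_def doubleton_eq_iff)+

lemma simple_graph_edgeE:
  assumes "simple_graph G" "e \<in> edges G"
  obtains u v where "e = {u, v}" "u \<in> verts G" "v \<in> verts G" "u \<noteq> v"
  using assms by (force simp: simple_graph_def)

lemma finite_edges: "simple_graph G \<Longrightarrow> finite (verts G) \<Longrightarrow> finite (edges G)"
  by (rule finite_subset[of _ "Pow (verts G)"]) (auto elim: simple_graph_edgeE)

lemma connected_graph_iff: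
  "connected_graph G \<longleftrightarrow> verts G \<noteq> {} \<and> (\<forall>u\<in>verts G. \<forall>v\<in>verts G. linked (edges G) u v)"
  by (simp add: connected_graph_def path_iff_linked)

lemma edges_bunkbed:
  "edges (bunkbed_graph G T) = {{(u, l), (v, l)} |u v l. {u, v} \<in> edges G \<and> l \<in> {0, 1}} \<union> {{(u, 0), (u, 1)} |u. u \<in> T}"
  by (simp add: bunkbed_graph_def)

lemma edges_bunkbed_subset:
  assumes "simple_graph G" "T \<subseteq> verts G"
  shows "\<Union>(edges (bunkbed_graph G T)) \<subseteq> verts G \<times> {0, 1}"
  using assms(2) edge_in_simple_graph[OF assms(1)] by (auto simp: edges_bunkbed)

lemma finite_edges_bunkbed:
  assumes "simple_graph G" "T \<subseteq> verts G" "finite (verts G)"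
  shows "finite (edges (bunkbed_graph G T))"
  by (rule finite_subset[of _ "Pow (verts G \<times> {0, 1})"]) (use edges_bunkbed_subset[OF assms(1,2)] assms(3) in auto)

text \<open>A hypothesis on all finite graphs has to fix a vertex type, here \<open>nat\<close>. The
  graphs to which it is applied are slabs with vertices of another type, and every finite graph has
  an isomorphic copy on natural numbers.\<close>

lemma bunkbed_property_transfer:
  fixes G :: "'b sgraph"
  assumes p: "0 \<le> p" "p \<le> 1"
    and bunkbed: "\<And>(G :: nat sgraph) T. finite_connected_graph G \<Longrightarrow> T \<subseteq> verts G \<Longrightarrow> bunkbed_property p G T"
    and G: "finite_connected_graph G" and T: "T \<subseteq> verts G"
  shows "bunkbed_property p G T"
proof -
  have G': "simple_graph G" "finite (verts G)" "connected_graph G"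
    using G by (auto simp: finite_connected_graph_def)
  obtain g :: "'b \<Rightarrow> nat" where g: "inj_on g (verts G)"
    using finite_imp_inj_to_nat_seg[OF G'(2)] by blast
  define K where "K = SGraph (g ` verts G) ((`) g ` edges G)"
  have "simple_graph K"
    unfolding simple_graph_def
  proof
    fix e assume "e \<in> edges K"
    then obtain a where a: "a \<in> edges G" "e = g ` a" by (auto simp: K_def)
    from G'(1) a(1) obtain u v where uv: "a = {u, v}" "u \<in> verts G" "v \<in> verts G" "u \<noteq> v"
      by (rule simple_graph_edgeE)
    with g a have "e = {g u, g v}" "g u \<noteq> g v" by (auto dest: inj_onD)
    with uv show "e \<in> {{u, v} |u v. u \<in> verts K \<and> v \<in> verts K \<and> u \<noteq> v}" by (auto simp: K_def)
  qed
  moreover have "connected_graph K"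
  proof -
    have "\<Union>(edges G) \<subseteq> verts G" using G'(1) by (auto elim: simple_graph_edgeE)
    then show ?thesis
      using G'(3) linked_image[OF g] unfolding connected_graph_iff by (simp add: K_def)
  qed
  ultimately have "finite_connected_graph K"
    using G'(2) by (simp add: finite_connected_graph_def K_def)
  then have bunkbed_K: "bunkbed_property p K (g ` T)" using T by (intro bunkbed) (auto simp: K_def)
  define f where "f = (\<lambda>(u, l :: nat). (g u, l))"
  have f: "inj_on f (verts G \<times> {0, 1})" using g by (auto simp: f_def inj_on_def)
  have edge: "{a, b} \<in> (`) g ` edges G \<longleftrightarrow> (\<exists>u v. {u, v} \<in> edges G \<and> a = g u \<and> b = g v)" for a b
  proof
    assume "{a, b} \<in> (`) g ` edges G"
    then obtain e where e: "e \<in> edges G" "{a, b} = g ` e" by auto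
    from G'(1) e(1) obtain u v where "e = {u, v}" by (rule simple_graph_edgeE)
    with e have "{u, v} \<in> edges G" "{v, u} \<in> edges G" "a = g u \<and> b = g v \<or> a = g v \<and> b = g u"
      by (auto simp: doubleton_eq_iff insert_commute)
    then show "\<exists>u v. {u, v} \<in> edges G \<and> a = g u \<and> b = g v" by blast
  next
    assume "\<exists>u v. {u, v} \<in> edges G \<and> a = g u \<and> b = g v"
    then obtain u v where "{u, v} \<in> edges G" "{a, b} = g ` {u, v}" by auto
    then show "{a, b} \<in> (`) g ` edges G" by blast
  qed
  have edges: "edges (bunkbed_graph K (g ` T)) = (`) f ` edges (bunkbed_graph G T)"
  proof (intro equalityI subsetI)
    fix e assume "e \<in> edges (bunkbed_graph K (g ` T))"
    then consider u v l where "e = {(g u, l), (g v, l)}" "{u, v} \<in> edges G" "l = 0 \<or> l = 1"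
      | u where "e = {(g u, 0), (g u, 1)}" "u \<in> T"
      unfolding edges_bunkbed by (auto simp: K_def edge)
    then show "e \<in> (`) f ` edges (bunkbed_graph G T)"
    proof cases
      case 1
      then have "e = f ` {(u, l), (v, l)}" "{(u, l), (v, l)} \<in> edges (bunkbed_graph G T)"
        by (auto simp: f_def edges_bunkbed)
      then show ?thesis by blast
    next
      case 2
      then have "e = f ` {(u, 0), (u, 1)}" "{(u, 0), (u, 1)} \<in> edges (bunkbed_graph G T)"
        by (auto simp: f_def edges_bunkbed)
      then show ?thesis by blast
    qed
  next
    fix e assume "e \<in> (`) f ` edges (bunkbed_graph G T)"
    then obtain a where a: "e = f ` a" "a \<in> edges (bunkbed_graph G T)" by blast
    from a(2) consider u v l where "a = {(u, l), (v, l)}" "{u, v} \<in> edges G" "l = 0 \<or> l = 1"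
      | u where "a = {(u, 0), (u, 1)}" "u \<in> T"
      unfolding edges_bunkbed by auto
    then show "e \<in> edges (bunkbed_graph K (g ` T))"
    proof cases
      case 1
      then have "e = {(g u, l), (g v, l)}" "{g u, g v} \<in> edges K"
        using a by (auto simp: f_def K_def edge)
      with 1 show ?thesis unfolding edges_bunkbed by blast
    next
      case 2
      then have "e = {(g u, 0), (g u, 1)}" using a by (auto simp: f_def)
      with 2 show ?thesis unfolding edges_bunkbed by blast
    qed
  qed
  have transfer: "connection_prob p (bunkbed_graph K (g ` T)) (g u, k) (g v, l)
      = connection_prob p (bunkbed_graph G T) (u, k) (v, l)"
    if "u \<in> verts G" "v \<in> verts G" "k \<in> {0, 1}" "l \<in> {0, 1}" for u v k l
    using connection_prob_relabel[OF p finite_edges_bunkbed[OF G'(1) T G'(2)]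
        edges_bunkbed_subset[OF G'(1) T] f _ _ edges, of "(u, k)" "(v, l)"] that
    by (simp add: f_def)
  show ?thesis
    using bunkbed_K transfer unfolding bunkbed_property_def by (simp add: K_def)
qed

section \<open>Slabs of finitely many layers\<close>

definition slab :: "'a sgraph \<Rightarrow> int \<Rightarrow> int \<Rightarrow> ('a \<times> int) sgraph" where
  "slab G a b = SGraph (verts G \<times> {a..b}) {e \<in> edges (layered_graph G). e \<subseteq> verts G \<times> {a..b}}"

lemma simple_graph_layered:
  assumes "simple_graph G"
  shows "simple_graph (layered_graph G)"
  using edge_in_simple_graph[OF assms] by (fastforce simp: simple_graph_def layered_graph_def)

lemma edges_slab_iff:
  assumes "simple_graph G"
  shows "{(u, k), (v, l)} \<in> edges (slab G a b) \<longleftrightarrow>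
    (k = l \<and> {u, v} \<in> edges G \<or> u = v \<and> u \<in> verts G \<and> \<bar>k - l\<bar> = 1) \<and> k \<in> {a..b} \<and> l \<in> {a..b}"
  using edge_in_simple_graph[OF assms] by (auto simp: slab_def edges_layered_iff)

lemma simple_graph_slab:
  assumes "simple_graph G"
  shows "simple_graph (slab G a b)"
  unfolding simple_graph_def
proof
  fix e assume "e \<in> edges (slab G a b)"
  then have e: "e \<in> edges (layered_graph G)" "e \<subseteq> verts (slab G a b)" by (auto simp: slab_def)
  from simple_graph_layered[OF assms] e(1) obtain x y where "e = {x, y}" "x \<noteq> y"
    by (rule simple_graph_edgeE)
  with e show "e \<in> {{u, v} |u v. u \<in> verts (slab G a b) \<and> v \<in> verts (slab G a b) \<and> u \<noteq> v}"
    by blast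
qed

text \<open>The bunkbed hypothesis speaks of connected graphs. Two vertices are joined by going down
  to the bottom layer, along a path of \<open>G\<close> there, and up again.\<close>

lemma finite_connected_slab:
  assumes G: "finite_connected_graph G" and "a \<le> b"
  shows "finite_connected_graph (slab G a b)"
proof -
  have G': "simple_graph G" "finite (verts G)" "connected_graph G"
    using G by (auto simp: finite_connected_graph_def)
  let ?L = "linked (edges (slab G a b))"
  have horizontal: "?L (u, l) (v, l)" if "linked (edges G) u v" "l \<in> {a..b}" for u v l
    using that(1)
  proof (induction rule: rtrancl_induct)
    case (step y z)
    then have "{(y, l), (z, l)} \<in> edges (slab G a b)"
      using that(2) by (simp add: edges_slab_iff[OF G'(1)] adjacency_def)
    from linked_edge[OF this] step.IH show ?case by (rule rtrancl_trans[rotated])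
  qed simp
  have vertical: "l \<le> b \<Longrightarrow> ?L (u, a) (u, l)" if "u \<in> verts G" "a \<le> l" for u l
    using that(2)
  proof (induction l rule: int_ge_induct)
    case (step l)
    then have "{(u, l), (u, l + 1)} \<in> edges (slab G a b)"
      using that(1) by (simp add: edges_slab_iff[OF G'(1)])
    moreover have "?L (u, a) (u, l)" using step by simp
    ultimately show ?case by (blast intro: rtrancl_trans linked_edge)
  qed simp
  have "?L (u, k) (v, l)" if uv: "u \<in> verts G" "v \<in> verts G" "k \<in> {a..b}" "l \<in> {a..b}" for u v k l
  proof -
    have "?L (u, k) (u, a)" using vertical[of u k] uv by (auto intro!: linked_sym[of "(u, a)"])
    also have "?L (u, a) (v, a)"
      using G'(3) uv \<open>a \<le> b\<close> by (intro horizontal) (auto simp: connected_graph_iff)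
    also have "?L (v, a) (v, l)" using vertical[of v l] uv by auto
    finally show ?thesis .
  qed
  then have "connected_graph (slab G a b)"
    using G'(3) \<open>a \<le> b\<close> by (auto simp: connected_graph_iff slab_def)
  then show ?thesis
    using simple_graph_slab[OF G'(1)] G'(2) by (simp add: finite_connected_graph_def slab_def)
qed

text \<open>Reflection at the height \<open>n + 1/2\<close> exchanges the layers \<open>n\<close> and \<open>n + 1\<close> and exhibits a slab around this
  height as a bunkbed graph whose vertical posts are the edges between these two layers.\<close>

definition unfold_bunkbed :: "int \<Rightarrow> ('a \<times> int) \<times> nat \<Rightarrow> 'a \<times> int" where
  "unfold_bunkbed n = (\<lambda>((x, l), b). (x, if b = 0 then l else 2 * n + 1 - l))"

lemma unfold_bunkbed_edges:
  fixes n k :: int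
  assumes G: "simple_graph G" and k: "0 \<le> k"
  shows "(`) (unfold_bunkbed n) ` edges (bunkbed_graph (slab G (n - k) n) (verts G \<times> {n}))
    = edges (slab G (n - k) (n + 1 + k))"
    (is "(`) ?f ` ?B = ?S")
proof (intro equalityI subsetI)
  fix e assume "e \<in> (`) ?f ` ?B"
  then obtain a where a: "e = ?f ` a" "a \<in> ?B" by blast
  from a(2) consider u h v l b where "a = {((u, h), b), ((v, l), b)}" "{(u, h), (v, l)} \<in> edges (slab G (n - k) n)" "b = 0 \<or> b = 1"
    | u where "a = {((u, n), 0), ((u, n), 1)}" "u \<in> verts G"
    unfolding edges_bunkbed by auto
  then show "e \<in> ?S"
  proof cases
    case 1
    from 1(3) have e: "e = {(u, h), (v, l)} \<or> e = {(u, 2 * n + 1 - h), (v, 2 * n + 1 - l)}"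
      using a(1) 1(1) by (auto simp: unfold_bunkbed_def)
    \<comment> \<open>Reflection preserves differences of height, so vertical edges of the upper
      copy again join consecutive layers.\<close>
    have "\<bar>2 * n + 1 - h - (2 * n + 1 - l)\<bar> = \<bar>h - l\<bar>" by linarith
    with e 1(2) show ?thesis by (auto simp: edges_slab_iff[OF G])
  next
    case 2
    from 2 have "e = {(u, n), (u, n + 1)}" using a(1) by (auto simp: unfold_bunkbed_def)
    with 2 k show ?thesis by (simp add: edges_slab_iff[OF G])
  qed
next
  fix e assume "e \<in> ?S"
  then have e: "e \<in> edges (layered_graph G)" "e \<subseteq> verts G \<times> {n - k..n + 1 + k}"
    by (auto simp: slab_def)
  have low: "{(u, h), (v, l)} \<in> (`) ?f ` ?B" if "{(u, h), (v, l)} \<in> edges (slab G (n - k) n)" for u h v l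
  proof (rule image_eqI)
    show "{((u, h), 0), ((v, l), 0)} \<in> ?B" using that unfolding edges_bunkbed by blast
  qed (simp add: unfold_bunkbed_def)
  have high: "{(u, h), (v, l)} \<in> (`) ?f ` ?B"
    if "{(u, 2 * n + 1 - h), (v, 2 * n + 1 - l)} \<in> edges (slab G (n - k) n)" for u h v l
  proof (rule image_eqI)
    show "{((u, 2 * n + 1 - h), 1), ((v, 2 * n + 1 - l), 1)} \<in> ?B"
      using that unfolding edges_bunkbed by blast
  qed (simp add: unfold_bunkbed_def)
  from e(1) consider u v l where "e = {(u, l), (v, l)}" "{u, v} \<in> edges G"
    | u l where "e = {(u, l - 1), (u, l)}" "u \<in> verts G"
    unfolding layered_graph_def by auto
  then show "e \<in> (`) ?f ` ?B"
  proof cases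
    case 1
    then have l: "n - k \<le> l" "l \<le> n + 1 + k" using e(2) by auto
    show ?thesis
    proof (cases "l \<le> n")
      case True
      with 1 l show ?thesis unfolding 1(1) by (intro low) (simp add: edges_slab_iff[OF G])
    next
      case False
      with 1 l show ?thesis unfolding 1(1) by (intro high) (simp add: edges_slab_iff[OF G])
    qed
  next
    case 2
    then have l: "n - k \<le> l - 1" "l \<le> n + 1 + k" using e(2) by auto
    \<comment> \<open>A vertical edge lies in the lower copy, is a post, or lies in the reflected
      copy.\<close>
    consider "l \<le> n" | "l = n + 1" | "n + 2 \<le> l" by linarith
    then show ?thesis
    proof cases
      case 1
      with 2 l show ?thesis unfolding 2(1) by (intro low) (simp add: edges_slab_iff[OF G])
    next
      case [simp]: 2
      show ?thesis
      proof (rule image_eqI)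
        show "{((u, n), 0), ((u, n), 1)} \<in> ?B" using \<open>u \<in> verts G\<close> unfolding edges_bunkbed by blast
      qed (simp add: \<open>e = _\<close> unfold_bunkbed_def)
    next
      case 3
      with 2 l show ?thesis unfolding 2(1) by (intro high) (simp add: edges_slab_iff[OF G])
    qed
  qed
qed

lemma layered_limit:
  assumes p: "0 \<le> p" "p \<le> 1" and G: "simple_graph G" "finite (verts G)"
  shows "(\<lambda>k. prb p (edges (slab G (a - int k) (b + int k))) (\<lambda>S. linked S x y))
    \<longlonglongrightarrow> connection_prob p (layered_graph G) x y"
proof (rule connection_prob_limit[OF p])
  let ?E = "\<lambda>k. edges (slab G (a - int k) (b + int k))"
  show "incseq ?E"
    by (fastforce simp: incseq_def slab_def)
  show "finite (?E k)" for k
  proof (rule finite_edges)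
    show "simple_graph (slab G (a - int k) (b + int k))" by (rule simple_graph_slab[OF G(1)])
  qed (use G(2) in \<open>simp add: slab_def\<close>)
  show "(\<Union>k. ?E k) = edges (layered_graph G)"
  proof (intro equalityI subsetI)
    fix e assume e: "e \<in> edges (layered_graph G)"
    from simple_graph_layered[OF G(1)] e obtain u v
      where uv: "e = {u, v}" "u \<in> verts (layered_graph G)" "v \<in> verts (layered_graph G)"
      by (rule simple_graph_edgeE)
    define k where "k = nat (\<bar>a\<bar> + \<bar>b\<bar> + \<bar>snd u\<bar> + \<bar>snd v\<bar>)"
    have "snd u \<in> {a - int k..b + int k}" "snd v \<in> {a - int k..b + int k}" by (auto simp: k_def)
    with uv e have "e \<in> ?E k" by (auto simp: slab_def layered_graph_def)
    then show "e \<in> (\<Union>k. ?E k)" by blast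
  qed (auto simp: slab_def)
qed

text \<open>By \<open>0 \<le> n\<close> the starting point lies on the same side of the reflection
  as layer \<open>n\<close>, hence on level 0 of the bunkbed graph. The bunkbed inequality then
  compares \<open>(v, n)\<close> with its mirror image \<open>(v, n + 1)\<close>.\<close>

lemma layered_step:
  assumes p: "0 \<le> p" "p \<le> 1"
    and bunkbed: "\<And>k. 0 \<le> k \<Longrightarrow> bunkbed_property p (slab G (n - k) n) (verts G \<times> {n})"
    and G: "finite_connected_graph G" and wv: "w \<in> verts G" "v \<in> verts G" and n: "0 \<le> n"
  shows "connection_prob p (layered_graph G) (w, 0) (v, n + 1) \<le> connection_prob p (layered_graph G) (w, 0) (v, n)"
proof -
  have G': "simple_graph G" "finite (verts G)"
    using G by (auto simp: finite_connected_graph_def)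
  let ?Q = "\<lambda>l k. prb p (edges (slab G (n - int k) (n + 1 + int k))) (\<lambda>S. linked S (w, 0) (v, l))"
  \<comment> \<open>For \<open>k\<close> at least \<open>n\<close> the slab reaches down to layer 0
    and contains the starting point.\<close>
  have "?Q (n + 1) k \<le> ?Q n k" if k: "nat n \<le> k" for k
  proof -
    let ?S = "slab G (n - int k) n" and ?R = "slab G (n - int k) (n + 1 + int k)"
    let ?B = "bunkbed_graph ?S (verts G \<times> {n})"
    have S: "simple_graph ?S" "finite (verts ?S)" "verts G \<times> {n} \<subseteq> verts ?S"
      using simple_graph_slab[OF G'(1)] G'(2) by (auto simp: slab_def)
    have inj: "inj_on (unfold_bunkbed n) (verts ?S \<times> {0, 1})"
      by (auto simp: inj_on_def unfold_bunkbed_def slab_def)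
    have R: "edges ?R = (`) (unfold_bunkbed n) ` edges ?B"
      by (rule unfold_bunkbed_edges[OF G'(1), symmetric]) simp
    have wS: "(w, 0) \<in> verts ?S" "(v, n) \<in> verts ?S" using wv n k by (auto simp: slab_def)
    have conn: "?Q (if b = 0 then n else n + 1) k = connection_prob p ?B ((w, 0), 0) ((v, n), b)"
      if "b \<in> {0, 1}" for b
    proof -
      have "connection_prob p ?R (unfold_bunkbed n ((w, 0), 0)) (unfold_bunkbed n ((v, n), b))
          = connection_prob p ?B ((w, 0), 0) ((v, n), b)"
        using wS that by (intro connection_prob_relabel[OF p finite_edges_bunkbed[OF S(1,3,2)]
              edges_bunkbed_subset[OF S(1,3)] inj _ _ R]) auto
      moreover have "finite (edges ?R)"
        unfolding R using finite_edges_bunkbed[OF S(1,3,2)] by (rule finite_imageI)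
      ultimately show ?thesis
        using connection_prob_finite[OF p, of ?R] by (cases "b = 0") (simp_all add: unfold_bunkbed_def)
    qed
    have "connection_prob p ?B ((w, 0), 0) ((v, n), 1) \<le> connection_prob p ?B ((w, 0), 0) ((v, n), 0)"
      using bunkbed[of "int k"] wS unfolding bunkbed_property_def by simp
    then show ?thesis using conn[of 0] conn[of 1] by simp
  qed
  then show ?thesis
    by (intro LIMSEQ_le[OF layered_limit[OF p G'] layered_limit[OF p G']]) blast
qed

lemma layered_property_if_bunkbed:
  fixes G :: "'b sgraph"
  assumes p: "0 \<le> p" "p \<le> 1"
    and bunkbed: "\<And>(G :: nat sgraph) T. finite_connected_graph G \<Longrightarrow> T \<subseteq> verts G \<Longrightarrow> bunkbed_property p G T"
    and G: "finite_connected_graph G"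
  shows "layered_property p G"
  unfolding layered_property_def
proof (intro ballI allI impI)
  fix w v and n n' :: int
  assume wv: "w \<in> verts G" "v \<in> verts G" and n: "0 \<le> n \<and> n \<le> n'"
  let ?P = "\<lambda>n. connection_prob p (layered_graph G) (w, 0) (v, n)"
  from n have "n \<le> n'" ..
  then show "?P n' \<le> ?P n"
  proof (induction n' rule: int_ge_induct)
    case (step m)
    have "?P (m + 1) \<le> ?P m"
    proof (rule layered_step[OF p _ G wv])
      show "bunkbed_property p (slab G (m - k) m) (verts G \<times> {m})" if "0 \<le> k" for k
        using that by (intro bunkbed_property_transfer[OF p bunkbed] finite_connected_slab G) (auto simp: slab_def)
    qed (use n step in simp)
    with step show ?case by simp
  qed simp
qed

theorem proposition1:
  fixes p :: real
  assumes "0 < p" and "p < 1"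
  shows "((\<forall>(G :: nat sgraph) T. finite_connected_graph G \<and> T \<subseteq> verts G \<longrightarrow> bunkbed_property p G T)
            \<longrightarrow> (\<forall>G :: 'a sgraph. finite_connected_graph G \<longrightarrow> layered_property p G)) \<and>
         (\<forall>d::nat. d \<ge> 2 \<longrightarrow>
            ((\<forall>k\<ge>2. layered_property p (cartesian_power (cycle_graph k) (d - 1)))
               \<longrightarrow> lattice_monotone p d) \<and>
            ((\<forall>k\<ge>2. layered_property p (cartesian_power (linear_graph k) (d - 1)))
               \<longrightarrow> lattice_monotone p d))"
proof (intro conjI allI impI)
  fix G :: "'a sgraph"
  assume "\<forall>(G :: nat sgraph) T. finite_connected_graph G \<and> T \<subseteq> verts G \<longrightarrow> bunkbed_property p G T"
    and "finite_connected_graph G"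
  then show "layered_property p G"
    using assms by (intro layered_property_if_bunkbed) auto
next
  fix d :: nat
  assume "\<forall>k\<ge>2. layered_property p (cartesian_power (cycle_graph k) (d - 1))"
  then show "lattice_monotone p d"
    by (intro lattice_monotone_if_layered[OF assms locally_path_cycle]) simp
next
  fix d :: nat
  assume "\<forall>k\<ge>2. layered_property p (cartesian_power (linear_graph k) (d - 1))"
  then show "lattice_monotone p d"
    by (intro lattice_monotone_if_layered[OF assms locally_path_linear]) simp
qed

end
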